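(* Let $(i,j,k)$ be a permutation of $(1,2,3)$ and suppose that $P_i(a,b,c)=0$ and $P_j(a,b,c)P_k(a,b,c)\neq 0$. Then the number and the geometry of the 1-Weierstrass points of the quartic $C_{a,b,c}$ are given by one of the following: (i) $20$ ordinary flexes, forming five $H$-orbits of $4$ points each, and $2$ hyperflexes, forming one $H$-orbit of $2$ points; (ii) $12$ ordinary flexes, forming three $H$-orbits of $4$ points each, and $6$ hyperflexes, forming one $H$-orbit of $2$ points and one $H$-orbit of $4$ points; (iii) $4$ ordinary flexes, forming one $H$-orbit of $4$ points, and $10$ hyperflexes, forming one $H$-orbit of $2$ points and two $H$-orbits of $4$ points each.
   Context: All curves are over $\mathbb{C}$. For parameters $a,b,c\in\mathbb{C}$ with $(a^2-1)(b^2-1)(c^2-1)(a^2-4)(b^2-4)(c^2-4)(a^2+b^2+c^2-abc-4)\neq 0$, let $C_{a,b,c}\subset\mathbb{P}^2$ be the smooth plane quartic $x^4+y^4+z^4+ax^2y^2+bx^2z^2+cy^2z^2=0$. This condition on the parameters is assumed throughout. Put $P_1(a,b,c)=a^2+b^2-abc$, $P_2(a,b,c)=a^2+c^2-abc$, $P_3(a,b,c)=b^2+c^2-abc$. Let $H\cong C_2\times C_2$ be the group of projective transformations generated by $\sigma=\mathrm{diag}(-1,1,1)$ and $\tau=\mathrm{diag}(1,-1,1)$; it acts on $C_{a,b,c}$, and orbits are taken under this action. The 1-Weierstrass points of a smooth plane quartic $C$ (Weierstrass points with respect to the canonical divisor) are exactly its flexes, i.e. the points $p$ where the tangent line meets $C$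 at $p$ with contact order at least $3$. A flex is an ordinary flex if the contact order is exactly $3$, and a hyperflex if it is $4$.
   Formalization: The formal theorem adds the hypothesis that no two of a, b, c vanish; without it the claim fails: for a=b=0 and c≠0, all four points on x=0 are hyperflexes, forming two H-orbits of 2 points, which none of (i)–(iii) allows. *)

theory Defs
  imports
    "HOL-Analysis.Analysis"
    "HOL-Computational_Algebra.Polynomial"
    "HOL-Library.Multiset"
    "HOL-Algebra.Group_Action"
    "HOL-Algebra.Generated_Groups"
begin

text \<open>
  Points of the complex projective plane are the one-dimensional subspaces of \<open>complex ^ 3\<close>,
  and lines are the two-dimensional ones.  Since \<open>complex ^ 3\<close> also carries a real vector space
  structure, the complex span is \<open>vec.span\<close>, not \<open>span\<close>.
\<close>

definition proj_plane :: "(complex ^ 3) set set" where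
  "proj_plane = {vec.span {v} | v. v \<noteq> 0}"

definition proj_map :: "complex ^ 3 ^ 3 \<Rightarrow> (complex ^ 3) set \<Rightarrow> (complex ^ 3) set" where
  "proj_map A = (\<lambda>p\<in>proj_plane. (*v) A ` p)"

definition diag_mat :: "complex ^ 3 \<Rightarrow> complex ^ 3 ^ 3" where
  "diag_mat d = (\<chi> i j. if i = j then d $ i else 0)"

definition sigma :: "(complex ^ 3) set \<Rightarrow> (complex ^ 3) set" where
  "sigma = proj_map (diag_mat (vector [-1, 1, 1]))"

definition tau :: "(complex ^ 3) set \<Rightarrow> (complex ^ 3) set" where
  "tau = proj_map (diag_mat (vector [1, -1, 1]))"

definition H_group :: "((complex ^ 3) set \<Rightarrow> (complex ^ 3) set) monoid" where
  "H_group = BijGroup proj_plane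
     \<lparr>carrier := generate (BijGroup proj_plane) {sigma, tau}\<rparr>"

definition orbit_sizes :: "(complex ^ 3) set set \<Rightarrow> nat multiset" where
  "orbit_sizes E = image_mset card (mset_set (orbits H_group E (\<lambda>g. g)))"

text \<open>The form is polymorphic so that it can also be evaluated at vectors of polynomials.\<close>

definition quartic :: "'a::comm_ring_1 \<Rightarrow> 'a \<Rightarrow> 'a \<Rightarrow> 'a ^ 3 \<Rightarrow> 'a" where
  "quartic a b c v = (v $ 1) ^ 4 + (v $ 2) ^ 4 + (v $ 3) ^ 4
     + a * (v $ 1)\<^sup>2 * (v $ 2)\<^sup>2 + b * (v $ 1)\<^sup>2 * (v $ 3)\<^sup>2 + c * (v $ 2)\<^sup>2 * (v $ 3)\<^sup>2"

definition curve :: "complex \<Rightarrow> complex \<Rightarrow> complex \<Rightarrow> (complex ^ 3) set set" where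
  "curve a b c = {p \<in> proj_plane. \<forall>v\<in>p. quartic a b c v = 0}"

definition partial_quartic :: "complex \<Rightarrow> complex \<Rightarrow> complex \<Rightarrow> 3 \<Rightarrow> complex ^ 3 \<Rightarrow> complex" where
  "partial_quartic a b c i v = deriv (\<lambda>t. quartic a b c (v + t *s axis i 1)) 0"

definition tangent_line ::
    "complex \<Rightarrow> complex \<Rightarrow> complex \<Rightarrow> (complex ^ 3) set \<Rightarrow> (complex ^ 3) set" where
  "tangent_line a b c p = {w. \<forall>v\<in>p. (\<Sum>i\<in>UNIV. partial_quartic a b c i v * w $ i) = 0}"

text \<open>The polynomial \<open>F (v + t w)\<close> in the variable \<open>t\<close>, where \<open>F\<close> is the quartic form.\<close>

definition line_restriction ::
    "complex \<Rightarrow> complex \<Rightarrow> complex \<Rightarrow> complex ^ 3 \<Rightarrow> complex ^ 3 \<Rightarrow> complex poly" where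
  "line_restriction a b c v w = quartic [:a:] [:b:] [:c:] (\<chi> i. [:v $ i, w $ i:])"

text \<open>
  The contact order of the curve with the line \<open>L\<close> at a point \<open>p\<close> of \<open>L\<close> is the vanishing order
  at \<open>t = 0\<close> of \<open>F (v + t w)\<close>, where \<open>v\<close> spans \<open>p\<close> and \<open>v, w\<close> span \<open>L\<close>; it does not depend on
  the choice of \<open>v\<close> and \<open>w\<close>.  A line contained in the curve would need a separate convention, but
  a smooth quartic contains no line.
\<close>

definition contact_order ::
    "complex \<Rightarrow> complex \<Rightarrow> complex \<Rightarrow> (complex ^ 3) set \<Rightarrow> (complex ^ 3) set \<Rightarrow> nat" where
  "contact_order a b c L p =
     (THE m. \<exists>v w. p = vec.span {v} \<and> L = vec.span {v, w}
        \<and> m = Polynomial.order 0 (line_restriction a b c v w))"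

definition weierstrass_points :: "complex \<Rightarrow> complex \<Rightarrow> complex \<Rightarrow> (complex ^ 3) set set" where
  "weierstrass_points a b c =
     {p \<in> curve a b c. contact_order a b c (tangent_line a b c p) p \<ge> 3}"

definition ordinary_flexes :: "complex \<Rightarrow> complex \<Rightarrow> complex \<Rightarrow> (complex ^ 3) set set" where
  "ordinary_flexes a b c =
     {p \<in> weierstrass_points a b c. contact_order a b c (tangent_line a b c p) p = 3}"

definition hyperflexes :: "complex \<Rightarrow> complex \<Rightarrow> complex \<Rightarrow> (complex ^ 3) set set" where
  "hyperflexes a b c =
     {p \<in> weierstrass_points a b c. contact_order a b c (tangent_line a b c p) p = 4}"

text \<open>
  The points of the curve on the line \<open>x = 0\<close> are flexes (and then hyperflexes) iff
  \<open>a y\<^sup>2 + b z\<^sup>2 = 0\<close> there.  If \<open>(a, b) \<noteq> (0, 0)\<close>, this happens at some such point iff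
  \<open>P 1 a b c = 0\<close>, and then at exactly two of the four; if \<open>a = b = 0\<close> it happens at all four,
  which form two \<open>H\<close>-orbits.  Permuting the coordinates gives \<open>y = 0\<close> with \<open>(a, c)\<close> and \<open>P 2\<close>, and
  \<open>z = 0\<close> with \<open>(b, c)\<close> and \<open>P 3\<close>.  So "one orbit of two hyperflexes" requires that no two of
  \<open>a, b, c\<close> vanish, which \<open>P i = 0\<close>, \<open>P j P k \<noteq> 0\<close> alone does not give: \<open>a = b = 0\<close>, \<open>c \<noteq> 0\<close>.
\<close>

definition P :: "nat \<Rightarrow> complex \<Rightarrow> complex \<Rightarrow> complex \<Rightarrow> complex" where
  "P n a b c =
     (if n = 1 then a\<^sup>2 + b\<^sup>2 - a * b * c
      else if n = 2 then a\<^sup>2 + c\<^sup>2 - a * b * c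
      else b\<^sup>2 + c\<^sup>2 - a * b * c)"

end

theory Submission
  imports Defs "HOL-Computational_Algebra.Fundamental_Theorem_Algebra"
begin

text \<open>
  The substitution \<open>X = x\<^sup>2, Y = y\<^sup>2, Z = z\<^sup>2\<close> maps the quartic onto the conic
  \<open>Q = X\<^sup>2 + Y\<^sup>2 + Z\<^sup>2 + a X Y + b X Z + c Y Z = 0\<close>, and the \<open>H\<close>-orbits on the quartic are exactly the
  fibres of this map (\<open>orbit_span\<close>): four points over a point of the conic with \<open>X Y Z \<noteq> 0\<close>, two over
  a point with exactly one vanishing coordinate.  It therefore suffices to find the images of the
  flexes on the conic.

  Write \<open>q\<^sub>1, q\<^sub>2, q\<^sub>3\<close> for the partial derivatives of \<open>Q\<close> and \<open>\<Delta> = 4 + a b c - a\<^sup>2 - b\<^sup>2 - c\<^sup>2\<close>.  Restricting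
  the quartic to its tangent line (\<open>contact_order_eq\<close>) shows that a point is a flex iff its image lies on
  the cubic \<open>q\<^sub>1 q\<^sub>2 q\<^sub>3 + 4 \<Delta> X Y Z = 0\<close>, and that a flex is a hyperflex iff \<open>X Y Z = 0\<close> or
  \<open>X\<^sup>2 : Y\<^sup>2 : Z\<^sup>2 = c\<^sup>2 - 4 : b\<^sup>2 - 4 : a\<^sup>2 - 4\<close>.  The contact order never exceeds 4.

  Up to a permutation of the coordinates the vanishing form is \<open>P 1\<close>, so \<open>a\<^sup>2 + b\<^sup>2 = a b c\<close>.  Then the
  point \<open>(0 : b : -a)\<close> lies on the conic, the two points above it are hyperflexes, and its tangent line
  is \<open>a Y + b Z = 0\<close>.  The rest of the conic is an affine line with a parameter \<open>t\<close>, on which the cubic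
  becomes a polynomial of degree 5 in \<open>t\<close> (\<open>param_flex_iff\<close>).  None of its roots gives a point with
  \<open>X Y Z = 0\<close>; this is where the other two forms enter.  A root is multiple iff it gives
  hyperflexes, and there are no triple roots.  With \<open>r\<close> simple and \<open>s\<close> double roots,
  \<open>r + 2 s = 5\<close>, hence \<open>(r, s)\<close> is \<open>(5, 0)\<close>, \<open>(3, 1)\<close> or \<open>(1, 2)\<close>; these are the three cases, with
  \<open>r\<close> orbits of ordinary flexes and \<open>s\<close> orbits of hyperflexes of size 4, besides the orbit of size 2.
\<close>

section \<open>The restriction of the quartic form to a line\<close>

text \<open>
  In the expansion of \<open>F (s v + r w)\<close> the coefficient of \<open>s\<^sup>3 r\<close> is \<open>polar\<close>, the derivative of \<open>F\<close> at \<open>v\<close>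
  in direction \<open>w\<close>, and the coefficient of \<open>s\<^sup>2 r\<^sup>2\<close> is \<open>second_polar\<close>; the other mixed coefficient is
  \<open>polar\<close> with \<open>v\<close> and \<open>w\<close> exchanged.  Both are polymorphic because \<open>line_restriction\<close>
  evaluates the form at vectors of polynomials.
\<close>

definition polar :: "'a::comm_ring_1 \<Rightarrow> 'a \<Rightarrow> 'a \<Rightarrow> 'a ^ 3 \<Rightarrow> 'a ^ 3 \<Rightarrow> 'a" where
  "polar a b c v w =
     2 * v $ 1 * (2 * (v $ 1)\<^sup>2 + a * (v $ 2)\<^sup>2 + b * (v $ 3)\<^sup>2) * w $ 1
   + 2 * v $ 2 * (a * (v $ 1)\<^sup>2 + 2 * (v $ 2)\<^sup>2 + c * (v $ 3)\<^sup>2) * w $ 2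
   + 2 * v $ 3 * (b * (v $ 1)\<^sup>2 + c * (v $ 2)\<^sup>2 + 2 * (v $ 3)\<^sup>2) * w $ 3"

definition second_polar :: "'a::comm_ring_1 \<Rightarrow> 'a \<Rightarrow> 'a \<Rightarrow> 'a ^ 3 \<Rightarrow> 'a ^ 3 \<Rightarrow> 'a" where
  "second_polar a b c v w =
     6 * ((v $ 1)\<^sup>2 * (w $ 1)\<^sup>2 + (v $ 2)\<^sup>2 * (w $ 2)\<^sup>2 + (v $ 3)\<^sup>2 * (w $ 3)\<^sup>2)
   + a * ((v $ 1)\<^sup>2 * (w $ 2)\<^sup>2 + 4 * v $ 1 * v $ 2 * w $ 1 * w $ 2 + (v $ 2)\<^sup>2 * (w $ 1)\<^sup>2)
   + b * ((v $ 1)\<^sup>2 * (w $ 3)\<^sup>2 + 4 * v $ 1 * v $ 3 * w $ 1 * w $ 3 + (v $ 3)\<^sup>2 * (w $ 1)\<^sup>2)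
   + c * ((v $ 2)\<^sup>2 * (w $ 3)\<^sup>2 + 4 * v $ 2 * v $ 3 * w $ 2 * w $ 3 + (v $ 3)\<^sup>2 * (w $ 2)\<^sup>2)"

definition line_coeff :: "complex \<Rightarrow> complex \<Rightarrow> complex \<Rightarrow> complex ^ 3 \<Rightarrow> complex ^ 3 \<Rightarrow> nat \<Rightarrow> complex"
  where "line_coeff a b c v w i =
    [quartic a b c v, polar a b c v w, second_polar a b c v w, polar a b c w v, quartic a b c w] ! i"

lemma binomial_powers:
  fixes x y :: "'a::comm_ring_1"
  shows "(s * x + r * p) ^ 4 = x ^ 4 * s ^ 4 + 4 * x ^ 3 * p * (s ^ 3 * r)
      + 6 * x\<^sup>2 * p\<^sup>2 * (s\<^sup>2 * r\<^sup>2) + 4 * x * p ^ 3 * (s * r ^ 3) + p ^ 4 * r ^ 4"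
    and "(s * x + r * p)\<^sup>2 * (s * y + r * q)\<^sup>2 = x\<^sup>2 * y\<^sup>2 * s ^ 4
      + (2 * x * p * y\<^sup>2 + 2 * x\<^sup>2 * y * q) * (s ^ 3 * r)
      + (x\<^sup>2 * q\<^sup>2 + 4 * x * y * p * q + y\<^sup>2 * p\<^sup>2) * (s\<^sup>2 * r\<^sup>2)
      + (2 * x * p * q\<^sup>2 + 2 * p\<^sup>2 * y * q) * (s * r ^ 3) + p\<^sup>2 * q\<^sup>2 * r ^ 4"
  by (simp_all add: power2_eq_square power3_eq_cube power4_eq_xxxx algebra_simps)

lemma quartic_expand:
  fixes v w :: "'a::comm_ring_1 ^ 3"
  shows "quartic a b c (\<chi> i. s * v $ i + r * w $ i) =
    quartic a b c v * s ^ 4 + polar a b c v w * s ^ 3 * r + second_polar a b c v w * s\<^sup>2 * r\<^sup>2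
    + polar a b c w v * s * r ^ 3 + quartic a b c w * r ^ 4"
proof -
  have e: "polar a b c v w = 4 * (v $ 1) ^ 3 * w $ 1 + 4 * (v $ 2) ^ 3 * w $ 2 + 4 * (v $ 3) ^ 3 * w $ 3
     + a * (2 * v $ 1 * w $ 1 * (v $ 2)\<^sup>2 + 2 * (v $ 1)\<^sup>2 * v $ 2 * w $ 2)
     + b * (2 * v $ 1 * w $ 1 * (v $ 3)\<^sup>2 + 2 * (v $ 1)\<^sup>2 * v $ 3 * w $ 3)
     + c * (2 * v $ 2 * w $ 2 * (v $ 3)\<^sup>2 + 2 * (v $ 2)\<^sup>2 * v $ 3 * w $ 3)" for v w :: "'a ^ 3"
    by (simp add: polar_def power2_eq_square power3_eq_cube algebra_simps)
  show ?thesis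
    unfolding quartic_def second_polar_def vec_lambda_beta e mult.assoc[of a] mult.assoc[of b]
      mult.assoc[of c] binomial_powers
    by (simp add: ring_distribs mult_ac)
qed

lemma quartic_const_poly:
  fixes a b c :: complex
  shows
  "quartic [:a:] [:b:] [:c:] (\<chi> i. [:v $ i:]) = [:quartic a b c v:]"
  "polar [:a:] [:b:] [:c:] (\<chi> i. [:v $ i:]) (\<chi> i. [:w $ i:]) = [:polar a b c v w:]"
  "second_polar [:a:] [:b:] [:c:] (\<chi> i. [:v $ i:]) (\<chi> i. [:w $ i:]) = [:second_polar a b c v w:]"
proof -
  have n: "numeral k = [:numeral k :: complex:]" for k by (simp add: numeral_poly)
  show "quartic [:a:] [:b:] [:c:] (\<chi> i. [:v $ i:]) = [:quartic a b c v:]"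
    "polar [:a:] [:b:] [:c:] (\<chi> i. [:v $ i:]) (\<chi> i. [:w $ i:]) = [:polar a b c v w:]"
    "second_polar [:a:] [:b:] [:c:] (\<chi> i. [:v $ i:]) (\<chi> i. [:w $ i:]) = [:second_polar a b c v w:]"
    unfolding quartic_def polar_def second_polar_def vec_lambda_beta n
    by (simp_all add: poly_const_pow mult_ac)
qed

text \<open>
  A change of the spanning vectors replaces the two variables of the binary form \<open>F (s v + r w)\<close> by
  linear polynomials.  Expressing every restriction to the same line through the coefficients of one of
  them makes the order at \<open>0\<close> comparable.
\<close>

lemma line_restriction_combination:
  "line_restriction a b c (k *s v) (\<alpha> *s v + \<beta> *s w) =
     (\<Sum>i\<le>4. [:line_coeff a b c v w i:] * [:k, \<alpha>:] ^ (4 - i) * [:0, \<beta>:] ^ i)"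
proof -
  have "(\<chi> i. [:(k *s v) $ i, (\<alpha> *s v + \<beta> *s w) $ i:]) =
     (\<chi> i. [:k, \<alpha>:] * (\<chi> i. [:v $ i:]) $ i + [:0, \<beta>:] * (\<chi> i. [:w $ i:]) $ i)"
    by (simp add: vec_eq_iff algebra_simps)
  then show ?thesis
    unfolding line_restriction_def
    by (simp only: quartic_expand quartic_const_poly)
      (simp add: line_coeff_def eval_nat_numeral mult_ac)
qed

lemma order_0_times_power:
  fixes q :: "complex poly"
  assumes "\<beta> \<noteq> 0" "poly q 0 \<noteq> 0"
  shows "Polynomial.order 0 ([:0, \<beta>:] ^ m * q) = m"
proof -
  have q: "q \<noteq> 0" using assms(2) by auto
  have "[:0, \<beta>:] ^ m = monom (\<beta> ^ m) m"
    by (metis monom_altdef monom_0 monom_power mult_1 power_one_right monom_Suc One_nat_def)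
  moreover have "[:0, \<beta>:] ^ m * q \<noteq> 0" using q assms(1) by auto
  ultimately show ?thesis
    using assms q by (simp add: order_mult order_0I)
qed

text \<open>
  The order depends on the line and the point alone: the second variable becomes \<open>\<beta> t\<close>, of order
  one at \<open>0\<close>, and the first one has the nonzero value \<open>k\<close> there.
\<close>

lemma order_line_restriction:
  assumes "k \<noteq> 0" "\<beta> \<noteq> 0" "m \<le> 4"
    and low: "\<And>i. i < m \<Longrightarrow> line_coeff a b c v w i = 0" and "line_coeff a b c v w m \<noteq> 0"
  shows "Polynomial.order 0 (line_restriction a b c (k *s v) (\<alpha> *s v + \<beta> *s w)) = m"
proof -
  define q where "q = (\<Sum>i\<in>{m..4}. [:line_coeff a b c v w i:] * [:k, \<alpha>:] ^ (4 - i) * [:0, \<beta>:] ^ (i - m))"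
  have "line_restriction a b c (k *s v) (\<alpha> *s v + \<beta> *s w) =
     (\<Sum>i\<in>{m..4}. [:line_coeff a b c v w i:] * [:k, \<alpha>:] ^ (4 - i) * [:0, \<beta>:] ^ i)"
    unfolding line_restriction_combination
    by (rule sum.mono_neutral_right) (auto simp: low)
  also have "\<dots> = [:0, \<beta>:] ^ m * q"
    unfolding q_def sum_distrib_left
  proof (rule sum.cong)
    fix i assume "i \<in> {m..4}"
    then have "[:0, \<beta>:] ^ i = [:0, \<beta>:] ^ m * [:0, \<beta>:] ^ (i - m)"
      by (simp flip: power_add)
    then show "[:line_coeff a b c v w i:] * [:k, \<alpha>:] ^ (4 - i) * [:0, \<beta>:] ^ i =
      [:0, \<beta>:] ^ m * ([:line_coeff a b c v w i:] * [:k, \<alpha>:] ^ (4 - i) * [:0, \<beta>:] ^ (i - m))"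
      by (simp only: mult_ac)
  qed simp
  finally have eq: "line_restriction a b c (k *s v) (\<alpha> *s v + \<beta> *s w) = [:0, \<beta>:] ^ m * q" .
  have "poly q 0 = (\<Sum>i\<in>{m..4}. line_coeff a b c v w i * k ^ (4 - i) * 0 ^ (i - m))"
    by (simp add: q_def poly_sum poly_power mult.assoc)
  also have "\<dots> = (\<Sum>i\<in>{m}. line_coeff a b c v w i * k ^ (4 - i) * 0 ^ (i - m))"
    by (rule sum.mono_neutral_right) (use \<open>m \<le> 4\<close> in auto)
  finally have "poly q 0 \<noteq> 0" using assms by simp
  then show ?thesis unfolding eq by (rule order_0_times_power[OF \<open>\<beta> \<noteq> 0\<close>])
qed

lemma mem_span_singleton: "w \<in> vec.span {v} \<longleftrightarrow> (\<exists>k. w = k *s v)"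
  by (auto simp: vec.span_singleton)

lemma mem_span_pair: "u \<in> vec.span {v, w} \<longleftrightarrow> (\<exists>\<alpha> \<beta>. u = \<alpha> *s v + \<beta> *s w)"
  unfolding vec.span_breakdown_eq[of u v] mem_span_singleton
  by (metis add.commute add_diff_cancel_right' diff_add_cancel)

lemma span_eq_iff:
  assumes "v \<noteq> 0"
  shows "vec.span {v} = vec.span {w} \<longleftrightarrow> (\<exists>k. k \<noteq> 0 \<and> w = k *s v)"
proof
  assume eq: "vec.span {v} = vec.span {w}"
  have "w \<in> vec.span {v}" unfolding eq by (simp add: vec.span_base)
  moreover have "v \<in> vec.span {w}" unfolding eq[symmetric] by (simp add: vec.span_base)
  ultimately
  obtain k l where "w = k *s v" "v = l *s w" unfolding mem_span_singleton by blast
  then show "\<exists>k. k \<noteq> 0 \<and> w = k *s v"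
    using assms by (metis vec.scale_zero_left vec.scale_zero_right)
next
  assume "\<exists>k. k \<noteq> 0 \<and> w = k *s v"
  then obtain k where k: "k \<noteq> 0" "w = k *s v" by blast
  then have "w \<in> vec.span {v}" "v = (1 / k) *s w"
    by (auto simp: mem_span_singleton)
  then have "w \<in> vec.span {v}" "v \<in> vec.span {w}"
    using mem_span_singleton by blast+
  then show "vec.span {v} = vec.span {w}"
    by (simp add: vec.span_eq)
qed

lemma contact_order_eqI:
  assumes v: "v \<noteq> 0" and w: "w \<notin> vec.span {v}" and "m \<le> 4"
    and low: "\<And>i. i < m \<Longrightarrow> line_coeff a b c v w i = 0" and m: "line_coeff a b c v w m \<noteq> 0"
  shows "contact_order a b c (vec.span {v, w}) (vec.span {v}) = m"
  unfolding contact_order_def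
proof (rule the_equality)
  have "Polynomial.order 0 (line_restriction a b c (1 *s v) (0 *s v + 1 *s w)) = m"
    using order_line_restriction[OF _ _ \<open>m \<le> 4\<close> low m, of 1 1 0] by simp
  then show "\<exists>v' w'. vec.span {v} = vec.span {v'} \<and> vec.span {v, w} = vec.span {v', w'} \<and>
      m = Polynomial.order 0 (line_restriction a b c v' w')"
    by (intro exI[of _ v] exI[of _ w]) simp
next
  fix m'
  assume "\<exists>v' w'. vec.span {v} = vec.span {v'} \<and> vec.span {v, w} = vec.span {v', w'} \<and>
      m' = Polynomial.order 0 (line_restriction a b c v' w')"
  then obtain v' w' where v': "vec.span {v} = vec.span {v'}"
    and L: "vec.span {v, w} = vec.span {v', w'}"
    and m': "m' = Polynomial.order 0 (line_restriction a b c v' w')" by blast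
  obtain k where k: "k \<noteq> 0" "v' = k *s v" using v' span_eq_iff[OF v] by blast
  have "w' \<in> vec.span {v, w}" unfolding L by (simp add: vec.span_base)
  then obtain \<alpha> \<beta> where w': "w' = \<alpha> *s v + \<beta> *s w" by (auto simp: mem_span_pair)
  have "\<beta> \<noteq> 0"
  proof
    assume "\<beta> = 0"
    then have "w' \<in> vec.span {v'}" unfolding v'[symmetric] mem_span_singleton w' by auto
    then have "vec.span {v, w} = vec.span {v}"
      using vec.span_redundant[of w' "{v'}"] by (simp add: L v' insert_commute)
    moreover have "w \<in> vec.span {v, w}" by (simp add: vec.span_base)
    ultimately show False using w by simp
  qed
  then show "m' = m"
    unfolding m' k(2) w' by (intro order_line_restriction k(1) \<open>m \<le> 4\<close> low m)
qed

lemma partial_quartic_eq: "partial_quartic a b c i v = polar a b c v (axis i 1)"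
proof -
  have "quartic a b c (v + t *s axis i 1) =
    quartic a b c v + polar a b c v (axis i 1) * t + second_polar a b c v (axis i 1) * t\<^sup>2
    + polar a b c (axis i 1) v * t ^ 3 + quartic a b c (axis i 1) * t ^ 4" for t
    using quartic_expand[of a b c 1 v t "axis i 1"]
    by (simp add: plus_vec_def vector_scalar_mult_def)
  then have "partial_quartic a b c i v = deriv (\<lambda>t. quartic a b c v + polar a b c v (axis i 1) * t
      + second_polar a b c v (axis i 1) * t\<^sup>2
      + polar a b c (axis i 1) v * t ^ 3 + quartic a b c (axis i 1) * t ^ 4) 0"
    unfolding partial_quartic_def by simp
  also have "\<dots> = polar a b c v (axis i 1)"
    by (rule DERIV_imp_deriv) (auto intro!: derivative_eq_intros)
  finally show ?thesis .
qed

lemma tangent_line_eq: "tangent_line a b c (vec.span {v}) = {w. polar a b c v w = 0}"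
proof -
  have "(\<Sum>i\<in>UNIV. partial_quartic a b c i (k *s v) * w $ i) = k ^ 3 * polar a b c v w" for k w
    unfolding partial_quartic_eq sum_3
    by (simp add: polar_def axis_def algebra_simps power2_eq_square power3_eq_cube)
  then have "w \<in> tangent_line a b c (vec.span {v}) \<longleftrightarrow> (\<forall>k. k ^ 3 * polar a b c v w = 0)" for w
    unfolding tangent_line_def vec.span_singleton mem_Collect_eq ball_simps by simp
  moreover have "(\<forall>k::complex. k ^ 3 * y = 0) \<longleftrightarrow> y = 0" for y
    by (auto dest: spec[where x = 1])
  ultimately show ?thesis by blast
qed

lemma polar_linear:
  "polar a b c v (x + y) = polar a b c v x + polar a b c v y"
  "polar a b c v (k *s x) = k * polar a b c v x"
  by (simp_all add: polar_def algebra_simps)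

lemma dim_complex_3: "vec.dim (UNIV :: (complex ^ 3) set) = 3"
  using vec.dim_UNIV card_cart_basis[where ?'a = complex and 'i = 3] by simp

text \<open>
  A third independent vector in the tangent line would make the derivative of \<open>F\<close> vanish on all of
  \<open>complex ^ 3\<close>, which \<open>u\<close> prevents.
\<close>

lemma tangent_line_span:
  assumes v: "v \<noteq> 0" and w: "w \<notin> vec.span {v}"
    and z: "polar a b c v v = 0" "polar a b c v w = 0" "polar a b c v u \<noteq> 0"
  shows "tangent_line a b c (vec.span {v}) = vec.span {v, w}"
proof
  have sub: "vec.subspace {x. polar a b c v x = 0}"
    by (rule vec.subspaceI) (auto simp: polar_linear, simp add: polar_def)
  show "vec.span {v, w} \<subseteq> tangent_line a b c (vec.span {v})"
    unfolding tangent_line_eq using sub z by (intro vec.span_minimal) auto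
  show "tangent_line a b c (vec.span {v}) \<subseteq> vec.span {v, w}"
  proof
    fix x assume "x \<in> tangent_line a b c (vec.span {v})"
    then have x: "polar a b c v x = 0" by (simp add: tangent_line_eq)
    show "x \<in> vec.span {v, w}"
    proof (rule ccontr)
      assume nx: "x \<notin> vec.span {v, w}"
      have ind: "vec.independent {x, w, v}"
        using nx w v
        by (intro vec.independent_insertI)
          (auto simp: insert_commute vec.independent_empty)
      have "x \<noteq> w" "x \<noteq> v" "w \<noteq> v" using nx w by (auto intro: vec.span_base)
      then have "card {x, w, v} = 3" by simp
      then have "UNIV \<subseteq> vec.span {x, w, v}"
        by (intro vec.card_ge_dim_independent[OF _ ind]) (use dim_complex_3 in \<open>simp_all del: vec.dim_UNIV\<close>)
      moreover have "vec.span {x, w, v} \<subseteq> {x. polar a b c v x = 0}"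
        using sub z x by (intro vec.span_minimal) auto
      ultimately show False using z(3) by blast
    qed
  qed
qed

section \<open>Flexes in terms of the squared coordinates\<close>

definition sq :: "complex ^ 3 \<Rightarrow> complex ^ 3" where
  "sq v = (\<chi> i. (v $ i)\<^sup>2)"

definition conic_form :: "complex \<Rightarrow> complex \<Rightarrow> complex \<Rightarrow> complex ^ 3 \<Rightarrow> complex" where
  "conic_form a b c V = (V $ 1)\<^sup>2 + (V $ 2)\<^sup>2 + (V $ 3)\<^sup>2
     + a * V $ 1 * V $ 2 + b * V $ 1 * V $ 3 + c * V $ 2 * V $ 3"

text \<open>
  The three linear factors are the partial derivatives of the conic.  On the conic this form agrees
  up to sign with \<open>(c\<^sup>2 - 4) q\<^sub>1 Y Z + (b\<^sup>2 - 4) q\<^sub>2 X Z + (a\<^sup>2 - 4) q\<^sub>3 X Y\<close>, where \<open>q\<^sub>1, q\<^sub>2, q\<^sub>3\<close> are these derivatives.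
\<close>

definition flex_cubic :: "complex \<Rightarrow> complex \<Rightarrow> complex \<Rightarrow> complex ^ 3 \<Rightarrow> complex" where
  "flex_cubic a b c V =
     (2 * V $ 1 + a * V $ 2 + b * V $ 3) * (a * V $ 1 + 2 * V $ 2 + c * V $ 3)
       * (b * V $ 1 + c * V $ 2 + 2 * V $ 3)
     + 4 * (4 + a * b * c - a\<^sup>2 - b\<^sup>2 - c\<^sup>2) * V $ 1 * V $ 2 * V $ 3"

definition hyper_condition :: "complex \<Rightarrow> complex \<Rightarrow> complex \<Rightarrow> complex ^ 3 \<Rightarrow> bool" where
  "hyper_condition a b c V \<longleftrightarrow> V $ 1 * V $ 2 * V $ 3 = 0 \<or>
     ((b\<^sup>2 - 4) * (V $ 3)\<^sup>2 = (a\<^sup>2 - 4) * (V $ 2)\<^sup>2 \<and> (c\<^sup>2 - 4) * (V $ 3)\<^sup>2 = (a\<^sup>2 - 4) * (V $ 1)\<^sup>2)"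

text \<open>
  The last inequality says that the conic is smooth, the other three that it is not tangent to a
  coordinate line.
\<close>

definition nondegenerate :: "complex \<Rightarrow> complex \<Rightarrow> complex \<Rightarrow> bool" where
  "nondegenerate a b c \<longleftrightarrow> a\<^sup>2 \<noteq> 4 \<and> b\<^sup>2 \<noteq> 4 \<and> c\<^sup>2 \<noteq> 4 \<and> 4 + a * b * c - a\<^sup>2 - b\<^sup>2 - c\<^sup>2 \<noteq> 0"

lemma sq_nth [simp]: "sq v $ i = (v $ i)\<^sup>2"
  by (simp add: sq_def)

lemma sq_scale: "sq (k *s v) = k\<^sup>2 *s sq v"
  by (simp add: vec_eq_iff power_mult_distrib)

lemma sq_eq_0_iff [simp]: "sq v = 0 \<longleftrightarrow> v = 0"
  by (simp add: vec_eq_iff)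

lemma quartic_eq_conic_sq: "quartic a b c v = conic_form a b c (sq v)"
  by (simp add: quartic_def conic_form_def)

lemma proj_plane_iff: "p \<in> proj_plane \<longleftrightarrow> (\<exists>v. v \<noteq> 0 \<and> p = vec.span {v})"
  by (auto simp: proj_plane_def)

lemma span_in_proj_plane [simp]: "v \<noteq> 0 \<Longrightarrow> vec.span {v} \<in> proj_plane"
  by (auto simp: proj_plane_def)

lemma span_in_curve_iff:
  assumes "v \<noteq> 0"
  shows "vec.span {v} \<in> curve a b c \<longleftrightarrow> conic_form a b c (sq v) = 0"
proof -
  have "quartic a b c (k *s v) = k ^ 4 * quartic a b c v" for k
    by (simp add: quartic_def power_mult_distrib algebra_simps flip: power_add)
  moreover have "(\<forall>k::complex. k ^ 4 * y = 0) \<longleftrightarrow> y = 0" for y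
    by (auto dest: spec[where x = 1])
  ultimately show ?thesis
    using span_in_proj_plane[OF assms]
    by (simp add: curve_def vec.span_singleton quartic_eq_conic_sq)
qed

text \<open>
  The constant and the linear coefficient of the restriction to the tangent line vanish, so the contact
  order is read off from the remaining three.
\<close>

lemma tangent_contact_order:
  assumes v: "v \<noteq> 0" and w: "w \<notin> vec.span {v}"
    and F: "quartic a b c v = 0" "polar a b c v w = 0" and u: "polar a b c v u \<noteq> 0"
  defines "m \<equiv> contact_order a b c (tangent_line a b c (vec.span {v})) (vec.span {v})"
  shows "second_polar a b c v w \<noteq> 0 \<Longrightarrow> m = 2"
    and "second_polar a b c v w = 0 \<Longrightarrow> polar a b c w v \<noteq> 0 \<Longrightarrow> m = 3"
    and "second_polar a b c v w = 0 \<Longrightarrow> polar a b c w v = 0 \<Longrightarrow> quartic a b c w \<noteq> 0 \<Longrightarrow> m = 4"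
proof -
  have "polar a b c v v = 4 * quartic a b c v"
    by (simp add: polar_def quartic_def power2_eq_square power4_eq_xxxx algebra_simps)
  then have L: "tangent_line a b c (vec.span {v}) = vec.span {v, w}"
    using tangent_line_span[OF v w _ F(2) u] F(1) by simp
  have m: "m = n" if "n \<le> 4" "\<And>i. i < n \<Longrightarrow> line_coeff a b c v w i = 0"
    "line_coeff a b c v w n \<noteq> 0" for n
    unfolding m_def L using contact_order_eqI[OF v w that] .
  show "second_polar a b c v w \<noteq> 0 \<Longrightarrow> m = 2"
    by (rule m) (use F in \<open>auto simp: line_coeff_def less_Suc_eq numeral_eq_Suc\<close>)
  show "second_polar a b c v w = 0 \<Longrightarrow> polar a b c w v \<noteq> 0 \<Longrightarrow> m = 3"
    by (rule m) (use F in \<open>auto simp: line_coeff_def less_Suc_eq numeral_eq_Suc\<close>)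
  show "second_polar a b c v w = 0 \<Longrightarrow> polar a b c w v = 0 \<Longrightarrow> quartic a b c w \<noteq> 0 \<Longrightarrow> m = 4"
    by (rule m) (use F in \<open>auto simp: line_coeff_def less_Suc_eq numeral_eq_Suc\<close>)
qed

lemma binary_form_nonzero:
  fixes Y Z c :: complex
  assumes "Y\<^sup>2 + Z\<^sup>2 + c * Y * Z = 0" "Y \<noteq> 0 \<or> Z \<noteq> 0" "c\<^sup>2 \<noteq> 4"
  shows "Y \<noteq> 0" "Z \<noteq> 0" "2 * Y + c * Z \<noteq> 0" "c * Y + 2 * Z \<noteq> 0"
proof -
  show "Y \<noteq> 0" "Z \<noteq> 0" using assms by auto
  moreover have "(2 * Y + c * Z) * (c * Y + 2 * Z) = (4 - c\<^sup>2) * (Y * Z)"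
    using assms(1) by algebra
  ultimately show "2 * Y + c * Z \<noteq> 0" "c * Y + 2 * Z \<noteq> 0" using assms(3) by auto
qed

text \<open>
  At a point with a vanishing coordinate the tangent line passes through the opposite vertex of the
  coordinate triangle, because the form is even in that coordinate.  In the direction of this vertex the
  restriction is \<open>q t\<^sup>2 + t ^ 4\<close>, where \<open>q\<close> is the corresponding partial derivative of the conic; the
  other two derivatives do not vanish, since the conic is not tangent to the coordinate line.
\<close>

lemma contact_order_on_coordinate_line:
  assumes v: "v \<noteq> 0" "quartic a b c v = 0" "v $ 1 * v $ 2 * v $ 3 = 0" and nd: "nondegenerate a b c"
  shows "contact_order a b c (tangent_line a b c (vec.span {v})) (vec.span {v}) =
    (if flex_cubic a b c (sq v) = 0 then 4 else 2)"
proof -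
  have nd': "a\<^sup>2 \<noteq> 4" "b\<^sup>2 \<noteq> 4" "c\<^sup>2 \<noteq> 4" using nd by (auto simp: nondegenerate_def)
  have "\<exists>i j. v $ i = 0 \<and> v $ j \<noteq> 0 \<and> polar a b c v (axis j 1) \<noteq> 0 \<and>
    (flex_cubic a b c (sq v) = 0 \<longleftrightarrow> second_polar a b c v (axis i 1) = 0)"
  proof -
    consider "v $ 1 = 0" | "v $ 2 = 0" | "v $ 3 = 0" using v(3) by auto
    then show ?thesis
    proof cases
      case 1
      have "((v $ 2)\<^sup>2)\<^sup>2 + ((v $ 3)\<^sup>2)\<^sup>2 + c * (v $ 2)\<^sup>2 * (v $ 3)\<^sup>2 = 0"
        using v(2) 1 by (simp add: quartic_def)
      note * = binary_form_nonzero[OF this _ nd'(3)]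
      have "v $ 2 \<noteq> 0 \<or> v $ 3 \<noteq> 0" using v(1) 1 by (auto simp: vec_eq_iff forall_3)
      with * 1 show ?thesis
        by (intro exI[of _ 1] exI[of _ 2]) (auto simp: polar_def second_polar_def axis_def flex_cubic_def)
    next
      case 2
      have "((v $ 1)\<^sup>2)\<^sup>2 + ((v $ 3)\<^sup>2)\<^sup>2 + b * (v $ 1)\<^sup>2 * (v $ 3)\<^sup>2 = 0"
        using v(2) 2 by (simp add: quartic_def)
      note * = binary_form_nonzero[OF this _ nd'(2)]
      have "v $ 1 \<noteq> 0 \<or> v $ 3 \<noteq> 0" using v(1) 2 by (auto simp: vec_eq_iff forall_3)
      with * 2 show ?thesis
        by (intro exI[of _ 2] exI[of _ 1]) (auto simp: polar_def second_polar_def axis_def flex_cubic_def)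
    next
      case 3
      have "((v $ 1)\<^sup>2)\<^sup>2 + ((v $ 2)\<^sup>2)\<^sup>2 + a * (v $ 1)\<^sup>2 * (v $ 2)\<^sup>2 = 0"
        using v(2) 3 by (simp add: quartic_def)
      note * = binary_form_nonzero[OF this _ nd'(1)]
      have "v $ 1 \<noteq> 0 \<or> v $ 2 \<noteq> 0" using v(1) 3 by (auto simp: vec_eq_iff forall_3)
      with * 3 show ?thesis
        by (intro exI[of _ 3] exI[of _ 1]) (auto simp: polar_def second_polar_def axis_def flex_cubic_def)
    qed
  qed
  then obtain i j where i: "v $ i = 0" and nz: "polar a b c v (axis j 1) \<noteq> 0"
    and f: "flex_cubic a b c (sq v) = 0 \<longleftrightarrow> second_polar a b c v (axis i 1) = 0" by blast
  have w: "axis i 1 \<notin> vec.span {v}"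
  proof
    assume "axis i 1 \<in> vec.span {v}"
    then obtain k where "axis i 1 = k *s v" by (auto simp: mem_span_singleton)
    then have "axis i 1 $ i = k * v $ i" by simp
    then show False by (simp add: i)
  qed
  have p: "polar a b c v (axis i 1) = 0" "polar a b c (axis i 1) v = 0"
    "quartic a b c (axis i 1) = 1"
    using i exhaust_3[of i] by (auto simp: polar_def axis_def quartic_def)
  show ?thesis
    using tangent_contact_order[OF v(1) w v(2) p(1) nz] p f by auto
qed

text \<open>
  At a flex off the coordinate lines one of the equations in \<open>hyper_condition\<close> implies the others: writing
  \<open>d\<^sub>1, d\<^sub>2, d\<^sub>3\<close> for \<open>c\<^sup>2 - 4, b\<^sup>2 - 4, a\<^sup>2 - 4\<close>, the relations \<open>\<Sum> d\<^sub>i q\<^sub>i / X\<^sub>i = 0\<close> and \<open>\<Sum> q\<^sub>i X\<^sub>i = 0\<close>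
  make \<open>(d\<^sub>i / X\<^sub>i)\<close> and \<open>(X\<^sub>i)\<close> two vectors orthogonal to \<open>(q\<^sub>i)\<close>.  Their cross product is thus a multiple of
  \<open>(q\<^sub>i)\<close>, in which no entry is zero; so if one entry of it vanishes, all do.
\<close>

lemma hyper_condition_iff:
  assumes "conic_form a b c V = 0" "flex_cubic a b c V = 0" and nd: "nondegenerate a b c"
    and nz: "V $ 1 * V $ 2 * V $ 3 \<noteq> 0"
  shows "hyper_condition a b c V \<longleftrightarrow> (b\<^sup>2 - 4) * (V $ 3)\<^sup>2 = (a\<^sup>2 - 4) * (V $ 2)\<^sup>2"
proof -
  define X Y Z where XYZ: "X = V $ 1" "Y = V $ 2" "Z = V $ 3"
  define q1 q2 q3 where q: "q1 = 2*X + a*Y + b*Z" "q2 = a*X + 2*Y + c*Z" "q3 = b*X + c*Y + 2*Z"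
  define D where D: "D = 4 + a*b*c - a\<^sup>2 - b\<^sup>2 - c\<^sup>2"
  have Q: "X\<^sup>2 + Y\<^sup>2 + Z\<^sup>2 + a*X*Y + b*X*Z + c*Y*Z = 0"
    using assms(1) by (simp add: conic_form_def XYZ)
  have K: "q1 * q2 * q3 + 4 * D * X * Y * Z = 0"
    using assms(2) by (simp add: flex_cubic_def q D XYZ)
  have nz': "X \<noteq> 0" "Y \<noteq> 0" "Z \<noteq> 0" using nz by (auto simp: XYZ)
  have "D \<noteq> 0" using nd by (simp add: D nondegenerate_def)
  then have "q1 * q2 * q3 \<noteq> 0" using K nz' by auto
  then have "q1 * Y \<noteq> 0" using nz' by simp
  moreover have "q1 * Y * ((c\<^sup>2-4) * Z\<^sup>2 - (a\<^sup>2-4) * X\<^sup>2) = 0" if "(b\<^sup>2-4) * Z\<^sup>2 = (a\<^sup>2-4) * Y\<^sup>2"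
  proof -
    have "(c\<^sup>2-4)*q1*Y*Z + (b\<^sup>2-4)*q2*X*Z + (a\<^sup>2-4)*q3*X*Y = - (q1*q2*q3 + 4*D*X*Y*Z)"
      using q D Q by algebra
    then have g: "(c\<^sup>2-4)*q1*Y*Z + (b\<^sup>2-4)*q2*X*Z + (a\<^sup>2-4)*q3*X*Y = 0" using K by simp
    have "q1*X + q2*Y + q3*Z = 0" using q Q by algebra
    then show ?thesis using g that by algebra
  qed
  ultimately show ?thesis using nz by (auto simp: hyper_condition_def simp flip: XYZ)
qed

text \<open>
  With the tangent direction \<open>(0, z q\<^sub>3, - y q\<^sub>2)\<close> the coefficient of \<open>t\<^sup>2\<close> is \<open>- X\<close> times the flex
  cubic, and at a flex the coefficient of \<open>t\<^sup>3\<close> is a nonzero multiple of \<open>(b\<^sup>2 - 4) Z\<^sup>2 - (a\<^sup>2 - 4) Y\<^sup>2\<close>.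
  The coefficients of \<open>t\<^sup>3\<close> and \<open>t ^ 4\<close> never vanish together.
\<close>

lemma contact_order_off_coordinate_lines:
  assumes v: "quartic a b c v = 0" "v $ 1 * v $ 2 * v $ 3 \<noteq> 0" and nd: "nondegenerate a b c"
  shows "contact_order a b c (tangent_line a b c (vec.span {v})) (vec.span {v}) =
    (if flex_cubic a b c (sq v) \<noteq> 0 then 2 else if hyper_condition a b c (sq v) then 4 else 3)"
proof -
  define x y z where xyz: "x = v $ 1" "y = v $ 2" "z = v $ 3"
  define X Y Z where XYZ: "X = x\<^sup>2" "Y = y\<^sup>2" "Z = z\<^sup>2"
  define q1 q2 q3 where q: "q1 = 2*X + a*Y + b*Z" "q2 = a*X + 2*Y + c*Z" "q3 = b*X + c*Y + 2*Z"
  define D where D: "D = 4 + a*b*c - a\<^sup>2 - b\<^sup>2 - c\<^sup>2"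
  define w :: "complex ^ 3" where "w = vector [0, z * q3, - y * q2]"
  have w: "w $ 1 = 0" "w $ 2 = z * q3" "w $ 3 = - y * q2" by (simp_all add: w_def)
  have nz: "x \<noteq> 0" "y \<noteq> 0" "z \<noteq> 0" "X \<noteq> 0" "Y \<noteq> 0" "Z \<noteq> 0" using v(2) by (auto simp: xyz XYZ)
  have D0: "D \<noteq> 0" using nd by (simp add: D nondegenerate_def)
  have Q: "X\<^sup>2 + Y\<^sup>2 + Z\<^sup>2 + a*X*Y + b*X*Z + c*Y*Z = 0"
    using v(1) by (simp add: quartic_eq_conic_sq conic_form_def XYZ xyz)
  have K: "flex_cubic a b c (sq v) = q1 * q2 * q3 + 4 * D * X * Y * Z"
    by (simp add: flex_cubic_def q D XYZ xyz)
  have q23: "q2 \<noteq> 0 \<or> q3 \<noteq> 0"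
  proof (rule ccontr)
    assume "\<not> ?thesis"
    then have "q2 = 0" "q3 = 0" by auto
    then have "D * X\<^sup>2 = 0" using Q q D by algebra
    then show False using D0 nz by simp
  qed
  have "v \<noteq> 0" using nz by (auto simp: xyz)
  moreover have "w \<notin> vec.span {v}"
  proof
    assume "w \<in> vec.span {v}"
    then obtain k where "w = k *s v" by (auto simp: mem_span_singleton)
    then have "k * x = 0" "z * q3 = k * y" "- y * q2 = k * z"
      using w by (simp_all add: xyz)
    then show False using nz q23 by auto
  qed
  moreover have "polar a b c v w = 0"
  proof -
    have "polar a b c v w = 2 * y * q2 * (z * q3) + 2 * z * q3 * (- y * q2)"
      by (simp add: polar_def w q XYZ xyz)
    then show ?thesis by simp
  qed
  moreover obtain u where "polar a b c v u \<noteq> 0"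
  proof -
    have "polar a b c v (axis 2 1) = 2 * y * q2" "polar a b c v (axis 3 1) = 2 * z * q3"
      by (simp_all add: polar_def axis_def q XYZ xyz)
    then show ?thesis using that nz q23 by (metis mult_eq_0_iff zero_neq_numeral)
  qed
  ultimately have order:
    "second_polar a b c v w \<noteq> 0 \<Longrightarrow>
      contact_order a b c (tangent_line a b c (vec.span {v})) (vec.span {v}) = 2"
    "second_polar a b c v w = 0 \<Longrightarrow> polar a b c w v \<noteq> 0 \<Longrightarrow>
      contact_order a b c (tangent_line a b c (vec.span {v})) (vec.span {v}) = 3"
    "second_polar a b c v w = 0 \<Longrightarrow> polar a b c w v = 0 \<Longrightarrow> quartic a b c w \<noteq> 0 \<Longrightarrow>
      contact_order a b c (tangent_line a b c (vec.span {v})) (vec.span {v}) = 4"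
    using tangent_contact_order[OF _ _ v(1)] by blast+
  have c2: "second_polar a b c v w = - X * flex_cubic a b c (sq v)"
  proof -
    have "second_polar a b c v w = 4*Y*Z*(q2\<^sup>2 + q3\<^sup>2 - c*q2*q3) + q2*q3*(Z*q3 + Y*q2)"
    proof -
      have "second_polar a b c v w = 6 * (Y * (Z * q3\<^sup>2) + Z * (Y * q2\<^sup>2)) + a * (X * (Z * q3\<^sup>2))
          + b * (X * (Y * q2\<^sup>2)) + c * (Y * (Y * q2\<^sup>2) - 4 * Y * Z * q2 * q3 + Z * (Z * q3\<^sup>2))"
        unfolding second_polar_def w xyz[symmetric] XYZ
        by (simp add: power2_eq_square algebra_simps)
      then show ?thesis using q by algebra
    qed
    also have "\<dots> = - X * (q1*q2*q3 + 4*D*X*Y*Z)" using q D Q by algebra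
    finally show ?thesis by (simp add: K)
  qed
  define M N where MN: "M = Z * q3\<^sup>2" "N = Y * q2\<^sup>2"
  define R where R: "R = M * (2 * q3 - c * q2) - N * (2 * q2 - c * q3)"
  have c3: "polar a b c w v = 2 * y * z * R"
    unfolding polar_def w xyz[symmetric] R MN XYZ by (simp add: power2_eq_square algebra_simps)
  have c4: "quartic a b c w = M\<^sup>2 + N\<^sup>2 + c * M * N"
    unfolding quartic_def w MN XYZ by (simp add: power2_eq_square power4_eq_xxxx algebra_simps)
  have c4_nz: "quartic a b c w \<noteq> 0" if "R = 0"
  proof
    assume 0: "quartic a b c w = 0"
    \<comment> \<open>Eliminating \<open>N\<close> or \<open>M\<close> from \<open>R = 0\<close> and \<open>M\<^sup>2 + N\<^sup>2 + c M N = 0\<close> leaves the factor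
        \<open>(4 - c\<^sup>2) (q\<^sub>2\<^sup>2 + q\<^sub>3\<^sup>2 - c q\<^sub>2 q\<^sub>3)\<close>, which the next identity shows to be nonzero.\<close>
    have "q2\<^sup>2 + q3\<^sup>2 - c * q2 * q3 = - D * X\<^sup>2" using q D Q by algebra
    then have "(4 - c\<^sup>2) * D * X\<^sup>2 * N\<^sup>2 = 0" "(4 - c\<^sup>2) * D * X\<^sup>2 * M\<^sup>2 = 0"
      using 0 that unfolding c4 R by algebra+
    moreover have "4 - c\<^sup>2 \<noteq> 0" using nd by (auto simp: nondegenerate_def)
    ultimately show False using D0 nz q23 by (auto simp: MN)
  qed
  have R_iff: "R = 0 \<longleftrightarrow> hyper_condition a b c (sq v)" if "flex_cubic a b c (sq v) = 0"
  proof -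
    have K0: "q1 * q2 * q3 + 4 * D * X * Y * Z = 0" using that K by simp
    then have "q1 * q2 * q3 \<noteq> 0" using D0 nz by auto
    moreover have "q1 * R = 2 * D * X^3 * ((b\<^sup>2-4) * Z\<^sup>2 - (a\<^sup>2-4) * Y\<^sup>2)"
      unfolding R MN using Q K0 q D by algebra
    ultimately have "R = 0 \<longleftrightarrow> (b\<^sup>2-4) * Z\<^sup>2 = (a\<^sup>2-4) * Y\<^sup>2"
      using D0 nz by auto
    then show ?thesis
      using hyper_condition_iff[OF _ that nd] v by (simp add: quartic_eq_conic_sq XYZ xyz)
  qed
  show ?thesis
    using order c2 c3 c4_nz R_iff nz by auto
qed

lemma contact_order_eq:
  assumes v: "v \<noteq> 0" "quartic a b c v = 0" and nd: "nondegenerate a b c"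
  shows "contact_order a b c (tangent_line a b c (vec.span {v})) (vec.span {v}) =
    (if flex_cubic a b c (sq v) \<noteq> 0 then 2 else if hyper_condition a b c (sq v) then 4 else 3)"
  using contact_order_on_coordinate_line[OF v _ nd] contact_order_off_coordinate_lines[OF v(2) _ nd]
  by (cases "v $ 1 * v $ 2 * v $ 3 = 0") (auto simp: hyper_condition_def)

definition ordinary_flex_square :: "complex \<Rightarrow> complex \<Rightarrow> complex \<Rightarrow> complex ^ 3 \<Rightarrow> bool" where
  "ordinary_flex_square a b c V \<longleftrightarrow>
     conic_form a b c V = 0 \<and> flex_cubic a b c V = 0 \<and> \<not> hyper_condition a b c V"

definition hyperflex_square :: "complex \<Rightarrow> complex \<Rightarrow> complex \<Rightarrow> complex ^ 3 \<Rightarrow> bool" where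
  "hyperflex_square a b c V \<longleftrightarrow>
     conic_form a b c V = 0 \<and> flex_cubic a b c V = 0 \<and> hyper_condition a b c V"

lemma flexes_by_squares:
  assumes nd: "nondegenerate a b c"
  shows "ordinary_flexes a b c = {vec.span {v} | v. v \<noteq> 0 \<and> ordinary_flex_square a b c (sq v)}"
    and "hyperflexes a b c = {vec.span {v} | v. v \<noteq> 0 \<and> hyperflex_square a b c (sq v)}"
    and "weierstrass_points a b c = ordinary_flexes a b c \<union> hyperflexes a b c"
proof -
  define \<kappa> where "\<kappa> p = contact_order a b c (tangent_line a b c p) p" for p
  have \<kappa>: "\<kappa> (vec.span {v}) =
      (if flex_cubic a b c (sq v) \<noteq> 0 then 2 else if hyper_condition a b c (sq v) then 4 else 3)"
    if "v \<noteq> 0" "conic_form a b c (sq v) = 0" for v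
    unfolding \<kappa>_def using contact_order_eq[OF that(1) _ nd] that(2)
    by (simp add: quartic_eq_conic_sq)
  have curve: "curve a b c = {vec.span {v} | v. v \<noteq> 0 \<and> conic_form a b c (sq v) = 0}"
  proof -
    have "curve a b c \<subseteq> proj_plane" by (auto simp: curve_def)
    then show ?thesis using span_in_curve_iff by (fastforce simp: proj_plane_def)
  qed
  have W: "weierstrass_points a b c = {p \<in> curve a b c. \<kappa> p \<ge> 3}"
    by (simp add: weierstrass_points_def \<kappa>_def)
  have O: "ordinary_flexes a b c = {p \<in> curve a b c. \<kappa> p = 3}"
    by (auto simp: ordinary_flexes_def W \<kappa>_def)
  have H: "hyperflexes a b c = {p \<in> curve a b c. \<kappa> p = 4}"
    by (auto simp: hyperflexes_def W \<kappa>_def)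
  have \<kappa>_values: "\<kappa> p \<in> {2, 3, 4}" if "p \<in> curve a b c" for p
  proof -
    obtain v where "p = vec.span {v}" "v \<noteq> 0" "conic_form a b c (sq v) = 0"
      using \<open>p \<in> curve a b c\<close> curve by blast
    then show ?thesis using \<kappa>[of v] by simp
  qed
  show "ordinary_flexes a b c = {vec.span {v} | v. v \<noteq> 0 \<and> ordinary_flex_square a b c (sq v)}"
    unfolding O curve ordinary_flex_square_def by (auto simp: \<kappa> split: if_splits)
  show "hyperflexes a b c = {vec.span {v} | v. v \<noteq> 0 \<and> hyperflex_square a b c (sq v)}"
    unfolding H curve hyperflex_square_def by (auto simp: \<kappa> split: if_splits)
  show "weierstrass_points a b c = ordinary_flexes a b c \<union> hyperflexes a b c"
    unfolding W O H using \<kappa>_values by force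
qed

section \<open>Orbits as fibres of the squaring map\<close>

definition signs :: "(complex ^ 3) set" where
  "signs = {s. \<forall>i. s $ i = 1 \<or> s $ i = -1}"

definition fibre :: "complex ^ 3 \<Rightarrow> (complex ^ 3) set set" where
  "fibre U = {vec.span {v} | v. sq v = U}"

lemma signsD: "s \<in> signs \<Longrightarrow> s $ i = 1 \<or> s $ i = -1"
  by (simp add: signs_def)

lemma signs_square: "s \<in> signs \<Longrightarrow> s $ i * s $ i = 1"
  using signsD[of s i] by auto

lemma signs_mult_self: "s \<in> signs \<Longrightarrow> s * s = 1"
  by (simp add: vec_eq_iff signs_square)

lemma signs_mult: "s \<in> signs \<Longrightarrow> t \<in> signs \<Longrightarrow> s * t \<in> signs"
  unfolding signs_def mem_Collect_eq vector_mult_component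
  by (metis mult_1 mult_minus1 minus_minus)

lemma sign_vector_nonzero: "s \<in> signs \<Longrightarrow> v \<noteq> 0 \<Longrightarrow> s * v \<noteq> 0"
  by (metis mult.assoc mult_1 mult_zero_right signs_mult_self)

lemma signs_normalise:
  assumes "s \<in> signs"
  shows "s $ 3 *s s \<in> signs" "(s $ 3 *s s) $ 3 = 1"
proof -
  have "(s $ 3 *s s) $ i = 1 \<or> (s $ 3 *s s) $ i = -1" for i
    using signsD[OF assms, of 3] signsD[OF assms, of i] by auto
  then show "s $ 3 *s s \<in> signs" by (simp add: signs_def)
  show "(s $ 3 *s s) $ 3 = 1" using signs_square[OF assms] by simp
qed

lemma signs_with_last_one:
  "{s \<in> signs. s $ 3 = 1} = {1, vector [-1, 1, 1], vector [1, -1, 1], vector [-1, -1, 1]}"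
  by (auto simp: signs_def forall_3 vec_eq_iff)

lemma span_sign_normalise:
  assumes "s \<in> signs" "v \<noteq> 0"
  shows "vec.span {(s $ 3 *s s) * v} = vec.span {s * v}"
proof -
  have "(s $ 3 *s s) * v = s $ 3 *s (s * v)" by (simp add: vec_eq_iff)
  moreover have "s $ 3 \<noteq> 0" using signsD[OF assms(1), of 3] by auto
  ultimately show ?thesis using span_eq_iff[OF sign_vector_nonzero[OF assms]] by metis
qed

lemma sq_eq_iff: "sq w = sq v \<longleftrightarrow> (\<exists>s\<in>signs. w = s * v)"
proof
  assume "sq w = sq v"
  then have *: "w $ i = v $ i \<or> w $ i = - v $ i" for i
    by (simp add: vec_eq_iff power2_eq_iff)
  define s :: "complex ^ 3" where "s = (\<chi> i. if w $ i = v $ i then 1 else -1)"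
  have "s \<in> signs" by (simp add: s_def signs_def)
  moreover have "w = s * v" using * by (auto simp: s_def vec_eq_iff)
  ultimately show "\<exists>s\<in>signs. w = s * v" by blast
next
  assume "\<exists>s\<in>signs. w = s * v"
  then obtain s where s: "s \<in> signs" "w = s * v" by blast
  have "(s $ i)\<^sup>2 = 1" for i using signs_square[OF s(1)] by (simp add: power2_eq_square)
  then show "sq w = sq v" by (simp add: s(2) vec_eq_iff power_mult_distrib)
qed

lemma proj_map_diag:
  assumes "v \<noteq> 0"
  shows "proj_map (diag_mat d) (vec.span {v}) = vec.span {d * v}"
proof -
  have "vec.span {v} \<in> proj_plane" using assms by simp
  moreover have "diag_mat d *v w = d * w" for w
    by (simp add: vec_eq_iff diag_mat_def matrix_vector_mult_def sum_3 forall_3)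
  moreover have "d * (k *s v) = k *s (d * v)" for k
    by (simp add: vec_eq_iff)
  ultimately show ?thesis
    by (auto simp: proj_map_def vec.span_singleton image_iff)
qed

lemma sign_map_in_Bij:
  assumes "s \<in> signs"
  shows "proj_map (diag_mat s) \<in> Bij proj_plane"
proof -
  have closed: "proj_map (diag_mat s) p \<in> proj_plane"
    and invol: "proj_map (diag_mat s) (proj_map (diag_mat s) p) = p" if "p \<in> proj_plane" for p
  proof -
    obtain v where v: "p = vec.span {v}" "v \<noteq> 0" using \<open>p \<in> proj_plane\<close> unfolding proj_plane_iff by blast
    have "s * v \<noteq> 0" using assms v(2) by (rule sign_vector_nonzero)
    moreover have "s * (s * v) = v"
      using assms by (simp add: signs_mult_self flip: mult.assoc)
    ultimately show "proj_map (diag_mat s) p \<in> proj_plane"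
      "proj_map (diag_mat s) (proj_map (diag_mat s) p) = p"
      using v by (simp_all add: proj_map_diag)
  qed
  then have "bij_betw (proj_map (diag_mat s)) proj_plane proj_plane"
    by (intro bij_betw_byWitness[where f' = "proj_map (diag_mat s)"]) auto
  then show ?thesis by (simp add: Bij_def proj_map_def)
qed

lemma sign_map_mult:
  assumes "s \<in> signs" "t \<in> signs"
  shows "proj_map (diag_mat s) \<otimes>\<^bsub>BijGroup proj_plane\<^esub> proj_map (diag_mat t) =
    proj_map (diag_mat (s * t))"
proof -
  have "compose proj_plane (proj_map (diag_mat s)) (proj_map (diag_mat t)) = proj_map (diag_mat (s * t))"
  proof (rule extensionalityI[of _ proj_plane])
    fix p :: "(complex ^ 3) set" assume "p \<in> proj_plane"
    moreover from this obtain v where "p = vec.span {v}" "v \<noteq> 0" unfolding proj_plane_iff by blast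
    ultimately show "compose proj_plane (proj_map (diag_mat s)) (proj_map (diag_mat t)) p
      = proj_map (diag_mat (s * t)) p"
      using assms by (simp add: compose_eq proj_map_diag sign_vector_nonzero mult.assoc)
  qed (auto simp: proj_map_def)
  then show ?thesis using assms by (simp add: BijGroup_def sign_map_in_Bij)
qed

lemma sign_map_one: "proj_map (diag_mat 1) = \<one>\<^bsub>BijGroup proj_plane\<^esub>"
proof -
  have "proj_map (diag_mat 1) = (\<lambda>p\<in>proj_plane. p)"
    by (rule extensionalityI[of _ proj_plane])
      (auto simp: proj_plane_iff proj_map_diag, auto simp: proj_map_def)
  then show ?thesis by (simp add: BijGroup_def)
qed

text \<open>
  All eight sign changes occur, not only those of the two generators and their product: opposite sign
  vectors act in the same way.
\<close>

lemma carrier_H_group: "carrier H_group = (\<lambda>s. proj_map (diag_mat s)) ` signs"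
proof -
  let ?G = "BijGroup (proj_plane :: (complex ^ 3) set set)"
  let ?f = "\<lambda>s. proj_map (diag_mat s)"
  interpret group ?G by (rule group_BijGroup)
  have one: "(1 :: complex ^ 3) \<in> signs" by (simp add: signs_def)
  have gens: "vector [-1, 1, 1] \<in> signs" "vector [1, -1, 1] \<in> signs"
    by (simp_all add: signs_def forall_3)
  have self_inverse: "inv\<^bsub>?G\<^esub> (?f s) = ?f s" if "s \<in> signs" for s
    using that by (intro inv_equality)
      (simp_all add: sign_map_mult signs_mult_self sign_map_one, simp_all add: BijGroup_def sign_map_in_Bij)
  have "generate ?G {sigma, tau} = ?f ` signs"
  proof
    show "generate ?G {sigma, tau} \<subseteq> ?f ` signs"
    proof
      fix g assume "g \<in> generate ?G {sigma, tau}"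
      then show "g \<in> ?f ` signs"
      proof (induction rule: generate.induct)
        case one
        then show ?case using \<open>1 \<in> signs\<close> by (metis sign_map_one imageI)
      next
        case (incl h)
        then show ?case using gens by (auto simp: sigma_def tau_def)
      next
        case (inv h)
        then show ?case using gens by (auto simp: sigma_def tau_def self_inverse)
      next
        case (eng h1 h2)
        then show ?case by (auto simp: sign_map_mult signs_mult)
      qed
    qed
    show "?f ` signs \<subseteq> generate ?G {sigma, tau}"
    proof
      fix g assume "g \<in> ?f ` signs"
      then obtain s where s: "s \<in> signs" "g = ?f s" by blast
      define t where "t = s $ 3 *s s"
      have t: "t \<in> {s \<in> signs. s $ 3 = 1}"
        using signs_normalise[OF s(1)] by (simp add: t_def)
      have "?f s = ?f t"
      proof (rule extensionalityI[of _ proj_plane])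
        fix p :: "(complex ^ 3) set" assume "p \<in> proj_plane"
        then obtain v where "p = vec.span {v}" "v \<noteq> 0" unfolding proj_plane_iff by blast
        then show "?f s p = ?f t p"
          by (simp add: proj_map_diag t_def span_sign_normalise[OF s(1)])
      qed (auto simp: proj_map_def)
      moreover have "t \<in> {1, vector [-1, 1, 1], vector [1, -1, 1], vector [-1, 1, 1] * vector [1, -1, 1]}"
      proof -
        have "vector [-1, 1, 1] * vector [1, -1, 1] = (vector [-1, -1, 1] :: complex ^ 3)"
          by (simp add: vec_eq_iff forall_3)
        then show ?thesis using t unfolding signs_with_last_one by simp
      qed
      moreover have "?f 1 \<in> generate ?G {sigma, tau}"
        by (simp add: sign_map_one generate.one)
      moreover have "sigma \<in> generate ?G {sigma, tau}" "tau \<in> generate ?G {sigma, tau}"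
        by (simp_all add: generate.incl)
      moreover from this have "?f (vector [-1, 1, 1] * vector [1, -1, 1]) \<in> generate ?G {sigma, tau}"
        using generate.eng[of sigma ?G _ tau] by (simp add: sigma_def tau_def sign_map_mult gens)
      ultimately show "g \<in> generate ?G {sigma, tau}"
        unfolding s(2) by (auto simp: sigma_def tau_def)
    qed
  qed
  then show ?thesis by (simp add: H_group_def)
qed

lemma orbit_span:
  assumes "v \<noteq> 0"
  shows "orbit H_group (\<lambda>g. g) (vec.span {v}) = fibre (sq v)"
proof -
  have "orbit H_group (\<lambda>g. g) (vec.span {v}) = (\<lambda>s. proj_map (diag_mat s) (vec.span {v})) ` signs"
    by (auto simp: orbit_def carrier_H_group)
  also have "\<dots> = fibre (sq v)"
    unfolding proj_map_diag[OF assms] fibre_def sq_eq_iff by blast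
  finally show ?thesis .
qed

text \<open>
  Proportional squares suffice, because every complex scalar is a square.
\<close>

lemma mem_fibre_iff:
  assumes "v \<noteq> 0" "U \<noteq> 0"
  shows "vec.span {v} \<in> fibre U \<longleftrightarrow> (\<exists>k. k \<noteq> 0 \<and> sq v = k *s U)"
proof
  assume "vec.span {v} \<in> fibre U"
  then obtain w where w: "vec.span {v} = vec.span {w}" "sq w = U" by (auto simp: fibre_def)
  have "w \<noteq> 0" using w(2) assms(2) by auto
  then obtain k where k: "k \<noteq> 0" "v = k *s w" using w(1)[symmetric] span_eq_iff by blast
  then have "sq v = k\<^sup>2 *s U" using w(2) by (simp add: sq_scale)
  then show "\<exists>k. k \<noteq> 0 \<and> sq v = k *s U" using k(1) by (intro exI[of _ "k\<^sup>2"]) simp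
next
  assume "\<exists>k. k \<noteq> 0 \<and> sq v = k *s U"
  then obtain k where k: "k \<noteq> 0" "sq v = k *s U" by blast
  define r where "r = 1 / csqrt k"
  have "r \<noteq> 0" "r\<^sup>2 = 1 / k" using k(1) by (simp_all add: r_def power_divide)
  then have "sq (r *s v) = U" "vec.span {v} = vec.span {r *s v}"
    using k span_eq_iff[OF assms(1)] by (auto simp: sq_scale)
  then show "vec.span {v} \<in> fibre U" by (auto simp: fibre_def)
qed

lemma exists_square_root: "\<exists>v. sq v = U"
proof
  show "sq (\<chi> i. csqrt (U $ i)) = U" by (simp add: vec_eq_iff)
qed

lemma fibre_sq: "fibre (sq v) = (\<lambda>s. vec.span {s * v}) ` signs"
  unfolding fibre_def sq_eq_iff by blast

text \<open>
  The eight sign vectors represent each point of the fibre twice, by opposite vectors; the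
  normalisation \<open>s\<^sub>3 = 1\<close> chooses one of the two.
\<close>

lemma card_fibre_generic:
  assumes "U $ 1 * U $ 2 * U $ 3 \<noteq> 0"
  shows "card (fibre U) = 4"
proof -
  obtain v where v: "sq v = U" using exists_square_root by blast
  have nz: "v $ 1 \<noteq> 0" "v $ 2 \<noteq> 0" "v $ 3 \<noteq> 0" using assms by (auto simp flip: v)
  then have v0: "v \<noteq> 0" by auto
  define S :: "(complex ^ 3) set" where "S = {s \<in> signs. s $ 3 = 1}"
  have S: "S \<subseteq> signs" "\<And>s. s \<in> S \<Longrightarrow> s $ 3 = 1" by (auto simp: S_def)
  have "card S = 4" unfolding S_def signs_with_last_one by (simp add: vec_eq_iff forall_3)
  moreover have "inj_on (\<lambda>s. vec.span {s * v}) S"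
  proof (rule inj_onI)
    fix s t assume st: "s \<in> S" "t \<in> S" "vec.span {s * v} = vec.span {t * v}"
    then obtain k where k: "t * v = k *s (s * v)"
      using span_eq_iff[OF sign_vector_nonzero[OF _ v0]] S(1) by blast
    then have "(t * v) $ 3 = (k *s (s * v)) $ 3" by simp
    then have "k = 1" using S(2) st nz by simp
    then have "t * v = s * v" using k by simp
    then show "s = t" using nz by (simp add: vec_eq_iff forall_3)
  qed
  moreover have "fibre U = (\<lambda>s. vec.span {s * v}) ` S"
  proof -
    have "vec.span {s * v} \<in> (\<lambda>s. vec.span {s * v}) ` S" if s: "s \<in> signs" for s
      using span_sign_normalise[OF s v0] signs_normalise[OF s]
      by (intro image_eqI[where x = "s $ 3 *s s"]) (simp_all add: S_def)
    then show ?thesis using S(1) by (auto simp: fibre_sq simp flip: v)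
  qed
  ultimately show ?thesis by (simp add: card_image)
qed

text \<open>
  Changing the sign of a zero coordinate has no effect, so only the sign of \<open>v\<^sub>j\<close> relative to \<open>v\<^sub>k\<close>
  matters.
\<close>

lemma card_fibre_on_coordinate_line:
  assumes "U $ i = 0" "U $ j \<noteq> 0" "U $ k \<noteq> 0" "distinct [i, j, k]"
  shows "card (fibre U) = 2"
proof -
  obtain v where v: "sq v = U" using exists_square_root by blast
  have nz: "v $ i = 0" "v $ j \<noteq> 0" "v $ k \<noteq> 0" using assms by (auto simp flip: v)
  then have v0: "v \<noteq> 0" by auto
  have ijk: "l = i \<or> l = j \<or> l = k" for l
    using assms(4) exhaust_3[of l] exhaust_3[of i] exhaust_3[of j] exhaust_3[of k] by auto
  define f :: "complex ^ 3" where "f = (\<chi> l. if l = j then -1 else 1)"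
  have f: "f \<in> signs" by (simp add: f_def signs_def)
  have "fibre U = {vec.span {v}, vec.span {f * v}}"
  proof -
    have "vec.span {s * v} \<in> {vec.span {v}, vec.span {f * v}}" if s: "s \<in> signs" for s
    proof -
      have sk: "s $ k \<noteq> 0" "s $ k * s $ k = 1" using signsD[OF s, of k] by auto
      have "v = s $ k *s (s * v) \<or> f * v = s $ k *s (s * v)"
      proof (cases "s $ j = s $ k")
        case True
        then have "v $ l = (s $ k *s (s * v)) $ l" for l
          using ijk[of l] nz sk by (auto simp flip: mult.assoc)
        then show ?thesis by (simp add: vec_eq_iff)
      next
        case False
        then have "s $ k * s $ j = -1" using signsD[OF s, of k] signsD[OF s, of j] by auto
        then have "(f * v) $ l = (s $ k *s (s * v)) $ l" for l
          using ijk[of l] nz sk assms(4) by (auto simp: f_def simp flip: mult.assoc)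
        then show ?thesis by (simp add: vec_eq_iff)
      qed
      then show ?thesis
        using span_eq_iff[OF sign_vector_nonzero[OF s v0]] sk(1) by blast
    qed
    moreover have "vec.span {v} = vec.span {1 * v}" by simp
    moreover have "1 \<in> signs" by (simp add: signs_def)
    ultimately show ?thesis unfolding v[symmetric] fibre_sq using f by blast
  qed
  moreover have "vec.span {v} \<noteq> vec.span {f * v}"
  proof
    assume "vec.span {v} = vec.span {f * v}"
    then obtain r where "f * v = r *s v" using span_eq_iff[OF v0] by blast
    then have "(f * v) $ j = (r *s v) $ j" "(f * v) $ k = (r *s v) $ k" by simp_all
    then show False using nz assms(4) by (auto simp: f_def)
  qed
  ultimately show ?thesis by simp
qed

lemma finite_signs: "finite signs"
proof (rule finite_subset)
  have "s \<in> (\<lambda>f. \<chi> i. f i) ` (UNIV \<rightarrow>\<^sub>E {1, -1 :: complex})" if "s \<in> signs" for s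
  proof (rule image_eqI)
    show "s = (\<chi> i. s $ i)" by simp
    show "($) s \<in> UNIV \<rightarrow>\<^sub>E {1, -1}" using signsD[OF that] by (auto simp: PiE_def)
  qed
  then show "signs \<subseteq> (\<lambda>f. \<chi> i. f i) ` (UNIV \<rightarrow>\<^sub>E {1, -1 :: complex})" by blast
  show "finite ((\<lambda>f. (\<chi> i. f i) :: complex ^ 3) ` (UNIV \<rightarrow>\<^sub>E {1, -1 :: complex}))"
    by (intro finite_imageI finite_PiE) auto
qed

text \<open>
  For a condition \<open>R\<close> that is invariant under scaling, \<open>T\<close> contains exactly one spanning vector of each
  projective point satisfying \<open>R\<close>.  Representing vectors are convenient here because square roots are taken of vectors.
\<close>

definition transversal :: "(complex ^ 3) set \<Rightarrow> (complex ^ 3 \<Rightarrow> bool) \<Rightarrow> bool" where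
  "transversal T R \<longleftrightarrow> finite T \<and> 0 \<notin> T \<and> (\<forall>U\<in>T. \<forall>k. k *s U \<in> T \<longrightarrow> k *s U = U) \<and>
     (\<forall>V. V \<noteq> 0 \<longrightarrow> (R V \<longleftrightarrow> (\<exists>U\<in>T. \<exists>k. k \<noteq> 0 \<and> V = k *s U)))"

lemma orbits_by_transversal:
  assumes T: "transversal T R" and E: "E = {vec.span {v} | v. v \<noteq> 0 \<and> R (sq v)}"
  shows "orbit_sizes E = image_mset (\<lambda>U. card (fibre U)) (mset_set T)"
    and "card E = (\<Sum>U\<in>T. card (fibre U))"
proof -
  have fin: "finite T" and nz: "\<And>U. U \<in> T \<Longrightarrow> U \<noteq> 0"
    and uniq: "\<And>U k. U \<in> T \<Longrightarrow> k *s U \<in> T \<Longrightarrow> k *s U = U"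
    and R: "\<And>V. V \<noteq> 0 \<Longrightarrow> R V \<longleftrightarrow> (\<exists>U\<in>T. \<exists>k. k \<noteq> 0 \<and> V = k *s U)"
    using T unfolding transversal_def by blast+
  have E_eq: "E = (\<Union>U\<in>T. fibre U)"
  proof -
    have "vec.span {v} \<in> (\<Union>U\<in>T. fibre U)" if v: "v \<noteq> 0" "R (sq v)" for v
    proof -
      obtain U k where "U \<in> T" "k \<noteq> 0" "sq v = k *s U" using R[of "sq v"] v by auto
      then show ?thesis using mem_fibre_iff[OF v(1) nz] by blast
    qed
    moreover have "p \<in> E" if U: "U \<in> T" and p: "p \<in> fibre U" for U p
    proof -
      obtain v where v: "p = vec.span {v}" "sq v = U" using p unfolding fibre_def by blast
      have "R U" using R[OF nz[OF U]] U by (metis vec.scale_one zero_neq_one)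
      moreover have "v \<noteq> 0" using v(2) nz[OF U] by auto
      ultimately show ?thesis unfolding E v(1) using v(2) by blast
    qed
    ultimately show ?thesis unfolding E by blast
  qed
  have disj: "fibre U \<inter> fibre U' = {}" if U: "U \<in> T" "U' \<in> T" "U \<noteq> U'" for U U'
  proof (rule ccontr)
    assume "fibre U \<inter> fibre U' \<noteq> {}"
    then obtain p where p: "p \<in> fibre U" "p \<in> fibre U'" by blast
    then obtain v where v: "p = vec.span {v}" "sq v = U" unfolding fibre_def by blast
    have v0: "v \<noteq> 0" using v(2) nz[OF U(1)] by auto
    then obtain k where "U = k *s U'"
      using p(2) mem_fibre_iff[OF v0 nz[OF U(2)]] unfolding v by blast
    then show False using uniq U by metis
  qed
  have ne: "fibre U \<noteq> {}" for U unfolding fibre_def using exists_square_root by blast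
  have inj: "inj_on fibre T"
  proof (rule inj_onI, rule ccontr)
    fix U U' assume U: "U \<in> T" "U' \<in> T" "fibre U = fibre U'" "U \<noteq> U'"
    then show False using disj[OF U(1,2,4)] ne[of U'] by simp
  qed
  have "orbits H_group E (\<lambda>g. g) = fibre ` T"
  proof
    show "orbits H_group E (\<lambda>g. g) \<subseteq> fibre ` T"
    proof
      fix B assume "B \<in> orbits H_group E (\<lambda>g. g)"
      then obtain p U where U: "U \<in> T" "p \<in> fibre U" and B: "B = orbit H_group (\<lambda>g. g) p"
        unfolding orbits_def E_eq by blast
      then obtain v where v: "p = vec.span {v}" "sq v = U" unfolding fibre_def by blast
      have "v \<noteq> 0" using v(2) nz[OF U(1)] by auto
      then show "B \<in> fibre ` T" using U(1) orbit_span v unfolding B by blast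
    qed
    show "fibre ` T \<subseteq> orbits H_group E (\<lambda>g. g)"
    proof
      fix B assume "B \<in> fibre ` T"
      then obtain U where U: "U \<in> T" "B = fibre U" by blast
      obtain v where v: "sq v = U" using exists_square_root by blast
      then have "v \<noteq> 0" using nz[OF U(1)] by auto
      moreover have "vec.span {v} \<in> E" unfolding E_eq fibre_def using U(1) v by blast
      ultimately show "B \<in> orbits H_group E (\<lambda>g. g)"
        unfolding orbits_def U(2) v[symmetric] using orbit_span by blast
    qed
  qed
  then show "orbit_sizes E = image_mset (\<lambda>U. card (fibre U)) (mset_set T)"
    unfolding orbit_sizes_def
    by (simp add: image_mset_mset_set[OF inj, symmetric] multiset.map_comp comp_def)
  have "finite (fibre U)" if "U \<in> T" for U
  proof -
    obtain v where v: "sq v = U" using exists_square_root by blast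
    show ?thesis unfolding v[symmetric] fibre_sq using finite_signs by (rule finite_imageI)
  qed
  then show "card E = (\<Sum>U\<in>T. card (fibre U))"
    unfolding E_eq by (intro card_UN_disjoint fin ballI impI disj)
qed

section \<open>The quintic of the flexes\<close>

lemma card_simple_plus_double_roots:
  fixes p :: "complex poly"
  assumes "\<And>x. \<lbrakk>poly p x = 0; poly (pderiv p) x = 0\<rbrakk> \<Longrightarrow> poly (pderiv (pderiv p)) x \<noteq> 0"
    and p: "p \<noteq> 0"
  shows "card {x. poly p x = 0 \<and> poly (pderiv p) x \<noteq> 0} +
    2 * card {x. poly p x = 0 \<and> poly (pderiv p) x = 0} = degree p"
proof -
  define S where "S = {x. poly p x = 0 \<and> poly (pderiv p) x \<noteq> 0}"
  define D where "D = {x. poly p x = 0 \<and> poly (pderiv p) x = 0}"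
  have fin: "finite S" "finite D"
    using poly_roots_finite[OF p] by (auto simp: S_def D_def)
  have S: "Polynomial.order x p = 1" if "x \<in> S" for x
  proof -
    have "pderiv p \<noteq> 0" "Polynomial.order x (pderiv p) = 0" "poly p x = 0"
      using that by (auto simp: S_def order_root)
    then show ?thesis using order_pderiv[of p x] p by simp
  qed
  have D: "Polynomial.order x p = 2" if "x \<in> D" for x
  proof -
    have r: "poly p x = 0" "poly (pderiv p) x = 0" "poly (pderiv (pderiv p)) x \<noteq> 0"
      using that assms(1) by (auto simp: D_def)
    then have nz: "pderiv p \<noteq> 0" "pderiv (pderiv p) \<noteq> 0" by auto
    have "Polynomial.order x (pderiv (pderiv p)) = 0" using r(3) by (rule order_0I)
    then have "Polynomial.order x (pderiv p) = 1"
      using order_pderiv[OF nz(1) r(2)] by simp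
    then show ?thesis using order_pderiv[OF p r(1)] by simp
  qed
  have "degree p = size (proots p)" by (simp add: size_proots_complex)
  also have "\<dots> = (\<Sum>x | poly p x = 0. Polynomial.order x p)"
    using p by (simp add: size_multiset_overloaded_eq)
  also have "{x. poly p x = 0} = S \<union> D" by (auto simp: S_def D_def)
  also have "(\<Sum>x\<in>S \<union> D. Polynomial.order x p) = (\<Sum>x\<in>S. Polynomial.order x p) + (\<Sum>x\<in>D. Polynomial.order x p)"
    by (intro sum.union_disjoint fin) (auto simp: S_def D_def)
  also have "\<dots> = card S + 2 * card D" using S D by simp
  finally show ?thesis by (simp add: S_def D_def)
qed

definition flex_quintic :: "complex \<Rightarrow> complex \<Rightarrow> complex poly" where
  "flex_quintic A B = [:1, 6, 3 * (A + B), 2 * (A + B) + 4 * A * B, 9 * A * B, 6 * A * B:]"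

text \<open>
  In the parametrisation below this is \<open>(b\<^sup>2 - 4) Z\<^sup>2 - (a\<^sup>2 - 4) Y\<^sup>2\<close> divided by \<open>a\<^sup>2 - b\<^sup>2\<close>, for \<open>A = a\<^sup>2\<close>
  and \<open>B = b\<^sup>2\<close>.
\<close>

definition hyper_quartic :: "complex \<Rightarrow> complex \<Rightarrow> complex \<Rightarrow> complex" where
  "hyper_quartic A B t = 4 - (A + B) - 2 * A * B * (t * (t + 1)) - 4 * A * B * (t * (t + 1))\<^sup>2"

lemma poly_flex_quintic:
  "poly (flex_quintic A B) t =
     (2 * t + 1) * (1 - A * t\<^sup>2) * (1 - B * t\<^sup>2)
     + 4 * t * (1 + A * (t * (t + 1))) * (1 + B * (t * (t + 1)))"
  unfolding flex_quintic_def poly_pCons poly_0 by algebra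

text \<open>
  The identity behind the multiplicities: for \<open>A, B \<noteq> 4\<close> neither \<open>t\<close> nor \<open>2 t + 1\<close> is zero at a root \<open>t\<close>
  of the quintic, so the derivative vanishes iff \<open>hyper_quartic\<close> does.
\<close>

lemma pderiv_flex_quintic:
  "(2 * t + 1) * poly (pderiv (flex_quintic A B)) t =
     6 * (poly (flex_quintic A B) t - t * hyper_quartic A B t)"
proof -
  have "poly (pderiv (flex_quintic A B)) t = 6 + 6 * (A + B) * t
      + 3 * (2 * (A + B) + 4 * A * B) * t\<^sup>2 + 36 * A * B * t ^ 3 + 30 * A * B * t ^ 4"
    by (simp add: flex_quintic_def pderiv_pCons power2_eq_square power3_eq_cube power4_eq_xxxx algebra_simps)
  then show ?thesis
    unfolding hyper_quartic_def poly_flex_quintic by algebra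
qed

text \<open>
  The derivative of the previous identity.  The derivative of \<open>hyper_quartic\<close> is
  \<open>- 2 A B (2 t + 1) ^ 3\<close>, and its zero \<open>- 1 / 2\<close> is not a root of the quintic for \<open>A, B \<noteq> 4\<close>; this
  excludes triple roots if also \<open>A, B \<noteq> 0\<close>.
\<close>

lemma pderiv_pderiv_flex_quintic:
  "2 * poly (pderiv (flex_quintic A B)) t + (2 * t + 1) * poly (pderiv (pderiv (flex_quintic A B))) t =
     6 * (poly (pderiv (flex_quintic A B)) t - hyper_quartic A B t + 2 * A * B * t * (2 * t + 1) ^ 3)"
proof -
  have "poly (pderiv (flex_quintic A B)) t = 6 + 6 * (A + B) * t
      + 3 * (2 * (A + B) + 4 * A * B) * t\<^sup>2 + 36 * A * B * t ^ 3 + 30 * A * B * t ^ 4"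
    "poly (pderiv (pderiv (flex_quintic A B))) t = 6 * (A + B)
      + 6 * (2 * (A + B) + 4 * A * B) * t + 108 * A * B * t\<^sup>2 + 120 * A * B * t ^ 3"
    by (simp_all add: flex_quintic_def pderiv_pCons power2_eq_square power3_eq_cube power4_eq_xxxx algebra_simps)
  then show ?thesis
    unfolding hyper_quartic_def by algebra
qed

lemma flex_quintic_root:
  assumes "poly (flex_quintic A B) t = 0" "A \<noteq> 4" "B \<noteq> 4"
  shows "t \<noteq> 0" "2 * t + 1 \<noteq> 0"
proof -
  show "t \<noteq> 0" using assms(1) by (auto simp: flex_quintic_def)
  have "32 * poly (flex_quintic A B) t = - 4 * (A - 4) * (B - 4)" if "2 * t + 1 = 0"
    using that unfolding poly_flex_quintic by algebra
  then show "2 * t + 1 \<noteq> 0" using assms by auto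
qed

lemma flex_quintic_double_root_iff:
  assumes "poly (flex_quintic A B) t = 0" "A \<noteq> 4" "B \<noteq> 4"
  shows "poly (pderiv (flex_quintic A B)) t = 0 \<longleftrightarrow> hyper_quartic A B t = 0"
  using pderiv_flex_quintic[of t A B] flex_quintic_root[OF assms] assms(1) by auto

lemma flex_quintic_no_triple_root:
  assumes "poly (flex_quintic A B) t = 0" "poly (pderiv (flex_quintic A B)) t = 0"
    and "A \<noteq> 0" "B \<noteq> 0" "A \<noteq> 4" "B \<noteq> 4"
  shows "poly (pderiv (pderiv (flex_quintic A B))) t \<noteq> 0"
proof -
  have "hyper_quartic A B t = 0" using flex_quintic_double_root_iff assms by blast
  then show ?thesis
    using pderiv_pderiv_flex_quintic[of A B t] flex_quintic_root[OF assms(1,5,6)] assms by auto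
qed

lemma degree_flex_quintic:
  "A \<noteq> 0 \<Longrightarrow> B \<noteq> 0 \<Longrightarrow> degree (flex_quintic A B) = 5"
  by (simp add: flex_quintic_def)

section \<open>The conic when the first form vanishes\<close>

definition one_zero_coordinate :: "complex ^ 3 \<Rightarrow> bool" where
  "one_zero_coordinate V \<longleftrightarrow> (\<exists>i j k. distinct [i, j, k] \<and> V $ i = 0 \<and> V $ j \<noteq> 0 \<and> V $ k \<noteq> 0)"

text \<open>
  \<open>S\<close> and \<open>D\<close> represent the simple and double roots of the quintic, and \<open>z\<close> the point of the conic
  outside the parametrised part.
\<close>

definition flex_orbit_structure :: "complex \<Rightarrow> complex \<Rightarrow> complex \<Rightarrow> bool" where
  "flex_orbit_structure a b c \<longleftrightarrow> (\<exists>S D z.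
     transversal S (ordinary_flex_square a b c) \<and> transversal (insert z D) (hyperflex_square a b c) \<and>
     z \<notin> D \<and> one_zero_coordinate z \<and> (\<forall>V\<in>S \<union> D. V $ 1 * V $ 2 * V $ 3 \<noteq> 0) \<and>
     card S + 2 * card D = 5)"

lemma square_conditions_scale:
  assumes "k \<noteq> 0"
  shows "ordinary_flex_square a b c (k *s V) \<longleftrightarrow> ordinary_flex_square a b c V"
    and "hyperflex_square a b c (k *s V) \<longleftrightarrow> hyperflex_square a b c V"
proof -
  have 1: "conic_form a b c (k *s V) = k\<^sup>2 * conic_form a b c V"
    by (simp add: conic_form_def power2_eq_square algebra_simps)
  have 2: "flex_cubic a b c (k *s V) = k ^ 3 * flex_cubic a b c V"
    by (simp add: flex_cubic_def power3_eq_cube algebra_simps)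
  have "k\<^sup>2 * x = k\<^sup>2 * y \<longleftrightarrow> x = y" for x y using assms by simp
  from this[of "(b\<^sup>2 - 4) * (V $ 3)\<^sup>2" "(a\<^sup>2 - 4) * (V $ 2)\<^sup>2"]
    this[of "(c\<^sup>2 - 4) * (V $ 3)\<^sup>2" "(a\<^sup>2 - 4) * (V $ 1)\<^sup>2"]
  have 3: "hyper_condition a b c (k *s V) = hyper_condition a b c V"
    using assms by (simp add: hyper_condition_def power_mult_distrib mult.left_commute)
  show "ordinary_flex_square a b c (k *s V) \<longleftrightarrow> ordinary_flex_square a b c V"
    "hyperflex_square a b c (k *s V) \<longleftrightarrow> hyperflex_square a b c V"
    using assms by (simp_all add: ordinary_flex_square_def hyperflex_square_def 1 2 3)
qed

text \<open>
  \<open>z\<close> is the point \<open>(0 : b : -a)\<close> of the conic, with tangent line \<open>a Y + b Z = 0\<close>.  Every other point can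
  be scaled so that \<open>a Y + b Z = a\<^sup>2 - b\<^sup>2\<close>, and \<open>X\<close> is then a coordinate on the rest of the conic: since
  \<open>a b (Y\<^sup>2 + Z\<^sup>2 + c Y Z) = (a Y + b Z) (b Y + a Z)\<close>, the equation of the conic determines \<open>b Y + a Z\<close> as a
  polynomial in \<open>X\<close>.  This is the map \<open>\<Phi>\<close>.
\<close>

context
  fixes a b c d :: complex and \<Phi> :: "complex \<Rightarrow> complex ^ 3" and z :: "complex ^ 3"
  assumes nd: "nondegenerate a b c" and a0: "a \<noteq> 0" and b0: "b \<noteq> 0"
    and P1: "a\<^sup>2 + b\<^sup>2 = a * b * c"
    and P23: "a\<^sup>2 + c\<^sup>2 - a * b * c \<noteq> 0" "b\<^sup>2 + c\<^sup>2 - a * b * c \<noteq> 0"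
  defines d: "d \<equiv> a\<^sup>2 - b\<^sup>2"
    and \<Phi>: "\<Phi> \<equiv> \<lambda>t. vector [d * t, a * (1 + b\<^sup>2 * (t * (t + 1))), - b * (1 + a\<^sup>2 * (t * (t + 1)))]"
    and z: "z \<equiv> vector [0, b, - a]"
begin

lemma d_nonzero: "d \<noteq> 0"
proof
  assume "d = 0"
  then have "a\<^sup>2 * b\<^sup>2 * (c\<^sup>2 - 4) = 0" using P1 d by algebra
  then show False using nd a0 b0 by (simp add: nondegenerate_def)
qed

lemma param_nth:
  "\<Phi> t $ 1 = d * t" "\<Phi> t $ 2 = a * (1 + b\<^sup>2 * (t * (t + 1)))"
  "\<Phi> t $ 3 = - b * (1 + a\<^sup>2 * (t * (t + 1)))"
  by (simp_all add: \<Phi>)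

text \<open>
  On the image of \<open>\<Phi>\<close> the partial derivatives of the conic factor, which turns the flex cubic into the
  quintic.
\<close>

lemma param_forms:
  shows "2 * \<Phi> t $ 1 + a * \<Phi> t $ 2 + b * \<Phi> t $ 3 = d * (2 * t + 1)"
    and "a * (a * \<Phi> t $ 1 + 2 * \<Phi> t $ 2 + c * \<Phi> t $ 3) = d * (1 - a\<^sup>2 * t\<^sup>2)"
    and "b * (b * \<Phi> t $ 1 + c * \<Phi> t $ 2 + 2 * \<Phi> t $ 3) = d * (1 - b\<^sup>2 * t\<^sup>2)"
    and "a\<^sup>2 * b\<^sup>2 * (4 + a * b * c - a\<^sup>2 - b\<^sup>2 - c\<^sup>2) = - d\<^sup>2"
    and "conic_form a b c (\<Phi> t) = 0"
proof -
  show "2 * \<Phi> t $ 1 + a * \<Phi> t $ 2 + b * \<Phi> t $ 3 = d * (2 * t + 1)"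
    unfolding param_nth d by algebra
  have "a * (a * \<Phi> t $ 1 + 2 * \<Phi> t $ 2 + c * \<Phi> t $ 3) =
      a\<^sup>2 * (d * t) + 2 * a\<^sup>2 * (1 + b\<^sup>2 * (t * (t + 1))) - (a * b * c) * (1 + a\<^sup>2 * (t * (t + 1)))"
    unfolding param_nth by algebra
  then show "a * (a * \<Phi> t $ 1 + 2 * \<Phi> t $ 2 + c * \<Phi> t $ 3) = d * (1 - a\<^sup>2 * t\<^sup>2)"
    unfolding P1[symmetric] d by algebra
  have "b * (b * \<Phi> t $ 1 + c * \<Phi> t $ 2 + 2 * \<Phi> t $ 3) =
      b\<^sup>2 * (d * t) + (a * b * c) * (1 + b\<^sup>2 * (t * (t + 1))) - 2 * b\<^sup>2 * (1 + a\<^sup>2 * (t * (t + 1)))"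
    unfolding param_nth by algebra
  then show "b * (b * \<Phi> t $ 1 + c * \<Phi> t $ 2 + 2 * \<Phi> t $ 3) = d * (1 - b\<^sup>2 * t\<^sup>2)"
    unfolding P1[symmetric] d by algebra
  have "a\<^sup>2 * b\<^sup>2 * (4 + a * b * c - a\<^sup>2 - b\<^sup>2 - c\<^sup>2) =
      a\<^sup>2 * b\<^sup>2 * (4 + (a * b * c) - a\<^sup>2 - b\<^sup>2) - (a * b * c)\<^sup>2" by algebra
  then show "a\<^sup>2 * b\<^sup>2 * (4 + a * b * c - a\<^sup>2 - b\<^sup>2 - c\<^sup>2) = - d\<^sup>2"
    unfolding P1[symmetric] d by algebra
  have "conic_form a b c (\<Phi> t) = (\<Phi> t $ 1)\<^sup>2 + (\<Phi> t $ 2)\<^sup>2 + (\<Phi> t $ 3)\<^sup>2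
     + a * \<Phi> t $ 1 * \<Phi> t $ 2 + b * \<Phi> t $ 1 * \<Phi> t $ 3
     - (a * b * c) * ((1 + b\<^sup>2 * (t * (t + 1))) * (1 + a\<^sup>2 * (t * (t + 1))))"
    unfolding conic_form_def param_nth by algebra
  also have "\<dots> = 0" unfolding P1[symmetric] param_nth d by algebra
  finally show "conic_form a b c (\<Phi> t) = 0" .
qed

lemma param_flex_iff: "flex_cubic a b c (\<Phi> t) = 0 \<longleftrightarrow> poly (flex_quintic (a\<^sup>2) (b\<^sup>2)) t = 0"
proof -
  define q1 q2 q3 D where q: "q1 = 2 * \<Phi> t $ 1 + a * \<Phi> t $ 2 + b * \<Phi> t $ 3"
    "q2 = a * \<Phi> t $ 1 + 2 * \<Phi> t $ 2 + c * \<Phi> t $ 3"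
    "q3 = b * \<Phi> t $ 1 + c * \<Phi> t $ 2 + 2 * \<Phi> t $ 3"
    "D = 4 + a * b * c - a\<^sup>2 - b\<^sup>2 - c\<^sup>2"
  have "a\<^sup>2 * b\<^sup>2 * flex_cubic a b c (\<Phi> t) =
      a * b * q1 * (a * q2) * (b * q3) + 4 * (a\<^sup>2 * b\<^sup>2 * D) * \<Phi> t $ 1 * \<Phi> t $ 2 * \<Phi> t $ 3"
    unfolding flex_cubic_def q[symmetric] by algebra
  also have "\<dots> = a * b * d ^ 3 * poly (flex_quintic (a\<^sup>2) (b\<^sup>2)) t"
  proof -
    have e: "q1 = d * (2 * t + 1)" "a * q2 = d * (1 - a\<^sup>2 * t\<^sup>2)" "b * q3 = d * (1 - b\<^sup>2 * t\<^sup>2)"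
      "a\<^sup>2 * b\<^sup>2 * D = - d\<^sup>2"
      using param_forms by (simp_all add: q)
    show ?thesis unfolding e poly_flex_quintic param_nth by algebra
  qed
  finally show ?thesis using a0 b0 d_nonzero by auto
qed

text \<open>
  If the second or third coordinate vanished at a root of the quintic, then one factor of
  \<open>(2 t + 1) (1 - a\<^sup>2 t\<^sup>2) (1 - b\<^sup>2 t\<^sup>2)\<close> would be zero too, forcing \<open>a\<^sup>2 = 4\<close>, \<open>b\<^sup>2 = 4\<close> or the
  vanishing of one of the other two forms.
\<close>

lemma param_flex_off_coordinate_lines:
  assumes "poly (flex_quintic (a\<^sup>2) (b\<^sup>2)) t = 0"
  shows "\<Phi> t $ 1 * \<Phi> t $ 2 * \<Phi> t $ 3 \<noteq> 0"
proof -
  have ne4: "a\<^sup>2 \<noteq> 4" "b\<^sup>2 \<noteq> 4" using nd by (simp_all add: nondegenerate_def)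
  have t: "t \<noteq> 0" "2 * t + 1 \<noteq> 0" using flex_quintic_root[OF assms ne4] .
  have "1 + b\<^sup>2 * (t * (t + 1)) \<noteq> 0"
  proof
    assume 0: "1 + b\<^sup>2 * (t * (t + 1)) = 0"
    then have "(2 * t + 1) * (1 - a\<^sup>2 * t\<^sup>2) * (1 - b\<^sup>2 * t\<^sup>2) = 0"
      using assms unfolding poly_flex_quintic by simp
    then consider "a\<^sup>2 * t\<^sup>2 = 1" | "b\<^sup>2 * t\<^sup>2 = 1" using t by auto
    then show False
    proof cases
      case 1
      then have "a\<^sup>2 * b\<^sup>2 * (a\<^sup>2 + c\<^sup>2 - a * b * c) = 0" using 0 P1 by algebra
      then show False using a0 b0 P23 by simp
    next
      case 2
      then have "b\<^sup>2 * (b\<^sup>2 - 4) = 0" using 0 by algebra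
      then show False using b0 ne4 by simp
    qed
  qed
  moreover have "1 + a\<^sup>2 * (t * (t + 1)) \<noteq> 0"
  proof
    assume 0: "1 + a\<^sup>2 * (t * (t + 1)) = 0"
    then have "(2 * t + 1) * (1 - a\<^sup>2 * t\<^sup>2) * (1 - b\<^sup>2 * t\<^sup>2) = 0"
      using assms unfolding poly_flex_quintic by simp
    then consider "a\<^sup>2 * t\<^sup>2 = 1" | "b\<^sup>2 * t\<^sup>2 = 1" using t by auto
    then show False
    proof cases
      case 1
      then have "a\<^sup>2 * (a\<^sup>2 - 4) = 0" using 0 by algebra
      then show False using a0 ne4 by simp
    next
      case 2
      then have "a\<^sup>2 * b\<^sup>2 * (b\<^sup>2 + c\<^sup>2 - a * b * c) = 0" using 0 P1 by algebra
      then show False using a0 b0 P23 by simp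
    qed
  qed
  ultimately show ?thesis using t a0 b0 d_nonzero by (simp add: param_nth)
qed

lemma param_hyper_iff:
  assumes "poly (flex_quintic (a\<^sup>2) (b\<^sup>2)) t = 0"
  shows "hyper_condition a b c (\<Phi> t) \<longleftrightarrow> poly (pderiv (flex_quintic (a\<^sup>2) (b\<^sup>2))) t = 0"
proof -
  have ne4: "a\<^sup>2 \<noteq> 4" "b\<^sup>2 \<noteq> 4" using nd by (simp_all add: nondegenerate_def)
  have "(b\<^sup>2 - 4) * (\<Phi> t $ 3)\<^sup>2 - (a\<^sup>2 - 4) * (\<Phi> t $ 2)\<^sup>2 = d * hyper_quartic (a\<^sup>2) (b\<^sup>2) t"
    unfolding param_nth hyper_quartic_def d by algebra
  then have "(b\<^sup>2 - 4) * (\<Phi> t $ 3)\<^sup>2 = (a\<^sup>2 - 4) * (\<Phi> t $ 2)\<^sup>2 \<longleftrightarrow> hyper_quartic (a\<^sup>2) (b\<^sup>2) t = 0"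
    using d_nonzero by (metis eq_iff_diff_eq_0 mult_eq_0_iff)
  then show ?thesis
    using hyper_condition_iff[OF param_forms(5) _ nd param_flex_off_coordinate_lines[OF assms]] param_flex_iff
      flex_quintic_double_root_iff[OF assms ne4] assms by simp
qed

lemma conic_points:
  assumes "V \<noteq> 0" "conic_form a b c V = 0"
  obtains k where "k \<noteq> 0" "V = k *s z" | k t where "k \<noteq> 0" "V = k *s \<Phi> t"
proof -
  define X Y Z where XYZ: "X = V $ 1" "Y = V $ 2" "Z = V $ 3"
  define u w where uw: "u = a * Y + b * Z" "w = b * Y + a * Z"
  have Q: "a * b * X\<^sup>2 + a * b * X * u + u * w = 0"
  proof -
    have "a * b * X\<^sup>2 + a * b * X * u + u * w
      = a * b * conic_form a b c V + (a\<^sup>2 + b\<^sup>2 - a * b * c) * (Y * Z)"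
      unfolding conic_form_def XYZ[symmetric] uw by algebra
    then show ?thesis using assms(2) P1 by simp
  qed
  show thesis
  proof (cases "u = 0")
    case True
    then have "X = 0" using Q a0 b0 by simp
    moreover have "Z = - a * (Y / b)" using True uw b0 by (simp add: field_simps) algebra
    ultimately have V: "V = (Y / b) *s z"
      using b0 by (simp add: vec_eq_iff forall_3 z flip: XYZ)
    moreover have "Y / b \<noteq> 0" using V assms(1) by auto
    ultimately show thesis using that(1) by blast
  next
    case False
    define k t where kt: "k = u / d" "t = X / u"
    have k: "k * d = u" "u * t = X" using d_nonzero False by (simp_all add: kt)
    have "a * b * u\<^sup>2 * (t * (t + 1)) = - (u * w)" using Q k by algebra
    then have s: "a * b * u * (t * (t + 1)) = - w"
      using False by (simp add: power2_eq_square mult.assoc) (metis mult_left_cancel mult.left_commute mult_minus_right)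
    have "d * (k * (a * (1 + b\<^sup>2 * (t * (t + 1))))) = d * Y"
      using s k(1) uw d by algebra
    moreover have "d * (k * (- b * (1 + a\<^sup>2 * (t * (t + 1))))) = d * Z"
      using s k(1) uw d by algebra
    moreover have "k * (d * t) = X" using k by (metis mult.assoc)
    ultimately have "k * \<Phi> t $ 1 = X" "k * \<Phi> t $ 2 = Y" "k * \<Phi> t $ 3 = Z"
      unfolding param_nth using d_nonzero by (metis mult_left_cancel)+
    then have "V = k *s \<Phi> t"
      by (simp add: vec_eq_iff forall_3 flip: XYZ)
    moreover have "k \<noteq> 0" using k False by auto
    ultimately show thesis using that(2) by blast
  qed
qed

lemma tangent_functional:
  "a * \<Phi> t $ 2 + b * \<Phi> t $ 3 = d" "a * z $ 2 + b * z $ 3 = 0"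
  by (simp_all add: param_nth z d power2_eq_square algebra_simps)

text \<open>
  The linear form \<open>a Y + b Z\<close> has the constant value \<open>d \<noteq> 0\<close> on the image of \<open>\<Phi>\<close> and vanishes at \<open>z\<close>;
  this fixes every scalar.
\<close>

lemma param_independent:
  "k *s \<Phi> t = \<Phi> t' \<Longrightarrow> k = 1 \<and> t = t'" "k *s \<Phi> t \<noteq> z" "k *s z \<noteq> \<Phi> t" "z \<noteq> 0" "\<Phi> t \<noteq> 0"
proof -
  have f: "a * (k *s V) $ 2 + b * (k *s V) $ 3 = k * (a * V $ 2 + b * V $ 3)" for k and V :: "complex ^ 3"
    by (simp add: algebra_simps)
  show z0: "z \<noteq> 0" using a0 by (auto simp: z vec_eq_iff forall_3)
  show "k *s \<Phi> t \<noteq> z"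
    using f[of k "\<Phi> t"] tangent_functional d_nonzero z0 by auto
  show "k *s z \<noteq> \<Phi> t"
    using f[of k z] tangent_functional d_nonzero by (metis mult_zero_right)
  show "\<Phi> t \<noteq> 0" using tangent_functional(1)[of t] d_nonzero by auto
  assume eq: "k *s \<Phi> t = \<Phi> t'"
  then have "k = 1" using f[of k "\<Phi> t"] tangent_functional d_nonzero by auto
  moreover have "(k *s \<Phi> t) $ 1 = \<Phi> t' $ 1" by (simp add: eq)
  ultimately show "k = 1 \<and> t = t'" using d_nonzero by (simp add: param_nth)
qed

lemma flex_orbit_structure_if_first_P_vanishes: "flex_orbit_structure a b c"
proof -
  define n where "n = flex_quintic (a\<^sup>2) (b\<^sup>2)"
  define S where "S = {t. poly n t = 0 \<and> poly (pderiv n) t \<noteq> 0}"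
  define D where "D = {t. poly n t = 0 \<and> poly (pderiv n) t = 0}"
  have ne4: "a\<^sup>2 \<noteq> 4" "b\<^sup>2 \<noteq> 4" using nd by (simp_all add: nondegenerate_def)
  have deg: "degree n = 5" using a0 b0 by (simp add: n_def degree_flex_quintic)
  then have n0: "n \<noteq> 0" by auto
  have fin: "finite S" "finite D"
    using poly_roots_finite[OF n0] by (auto simp: S_def D_def)
  have count: "card S + 2 * card D = 5"
    using card_simple_plus_double_roots[OF _ n0] flex_quintic_no_triple_root ne4 a0 b0 deg
    by (simp add: S_def D_def n_def)
  have inj: "inj \<Phi>"
    using param_independent(1)[of 1] by (auto simp: inj_def)
  have ord: "ordinary_flex_square a b c (\<Phi> t) \<longleftrightarrow> t \<in> S"
    and hyp: "hyperflex_square a b c (\<Phi> t) \<longleftrightarrow> t \<in> D" for t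
    using param_flex_iff[of t] param_hyper_iff[of t] param_forms(5)[of t]
    by (auto simp: ordinary_flex_square_def hyperflex_square_def S_def D_def n_def)
  have zc: "conic_form a b c z = 0" "flex_cubic a b c z = 0" "hyper_condition a b c z"
    using P1 by (simp_all add: conic_form_def flex_cubic_def hyper_condition_def z power2_eq_square algebra_simps)
  have pts: "V \<noteq> 0 \<Longrightarrow> conic_form a b c V = 0 \<Longrightarrow>
    (\<exists>k. k \<noteq> 0 \<and> V = k *s z) \<or> (\<exists>k t. k \<noteq> 0 \<and> V = k *s \<Phi> t)" for V
    using conic_points[of V] by metis
  have "transversal (\<Phi> ` S) (ordinary_flex_square a b c)"
    unfolding transversal_def
  proof (intro conjI allI impI ballI)
    show "0 \<notin> \<Phi> ` S" using param_independent(5) by auto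
    show "k *s U = U" if "U \<in> \<Phi> ` S" "k *s U \<in> \<Phi> ` S" for k U
      using that param_independent(1) by fastforce
    show "ordinary_flex_square a b c V \<longleftrightarrow> (\<exists>U\<in>\<Phi> ` S. \<exists>k. k \<noteq> 0 \<and> V = k *s U)" if "V \<noteq> 0" for V
    proof
      assume V: "ordinary_flex_square a b c V"
      then have "(\<exists>k. k \<noteq> 0 \<and> V = k *s z) \<or> (\<exists>k t. k \<noteq> 0 \<and> V = k *s \<Phi> t)"
        using pts that by (simp add: ordinary_flex_square_def)
      moreover have "\<not> ordinary_flex_square a b c z" using zc by (simp add: ordinary_flex_square_def)
      ultimately obtain k t where "k \<noteq> 0" "V = k *s \<Phi> t"
        using V square_conditions_scale(1) by blast
      then show "\<exists>U\<in>\<Phi> ` S. \<exists>k. k \<noteq> 0 \<and> V = k *s U"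
        using V ord square_conditions_scale(1) by blast
    qed (use ord square_conditions_scale(1) in blast)
  qed (use fin in simp)
  moreover have "transversal (insert z (\<Phi> ` D)) (hyperflex_square a b c)"
    unfolding transversal_def
  proof (intro conjI allI impI ballI)
    show "0 \<notin> insert z (\<Phi> ` D)" using param_independent(4,5) by (metis imageE insertE)
    show "k *s U = U" if "U \<in> insert z (\<Phi> ` D)" "k *s U \<in> insert z (\<Phi> ` D)" for k U
      using that param_independent(1,2,3) by fastforce
    show "hyperflex_square a b c V \<longleftrightarrow> (\<exists>U\<in>insert z (\<Phi> ` D). \<exists>k. k \<noteq> 0 \<and> V = k *s U)" if "V \<noteq> 0" for V
    proof
      assume V: "hyperflex_square a b c V"
      then have "(\<exists>k. k \<noteq> 0 \<and> V = k *s z) \<or> (\<exists>k t. k \<noteq> 0 \<and> V = k *s \<Phi> t)"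
        using pts that by (simp add: hyperflex_square_def)
      then show "\<exists>U\<in>insert z (\<Phi> ` D). \<exists>k. k \<noteq> 0 \<and> V = k *s U"
        using V hyp square_conditions_scale(2) by blast
    next
      have "hyperflex_square a b c z" using zc by (simp add: hyperflex_square_def)
      moreover assume "\<exists>U\<in>insert z (\<Phi> ` D). \<exists>k. k \<noteq> 0 \<and> V = k *s U"
      ultimately show "hyperflex_square a b c V" using hyp square_conditions_scale(2) by blast
    qed
  qed (use fin in simp)
  moreover have "z \<notin> \<Phi> ` D" using param_independent(2)[of 1] by auto
  moreover have "one_zero_coordinate z"
    unfolding one_zero_coordinate_def
    by (rule exI[of _ 1], rule exI[of _ 2], rule exI[of _ 3]) (simp add: z a0 b0)
  moreover have "\<forall>V\<in>\<Phi> ` S \<union> \<Phi> ` D. V $ 1 * V $ 2 * V $ 3 \<noteq> 0"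
    using param_flex_off_coordinate_lines by (auto simp: S_def D_def n_def)
  moreover have "card (\<Phi> ` S) + 2 * card (\<Phi> ` D) = 5"
    using count inj by (simp add: card_image inj_on_subset)
  ultimately show ?thesis unfolding flex_orbit_structure_def by blast
qed

end

section \<open>Permuting the coordinates\<close>

lemma transversal_transfer:
  assumes T: "transversal T R'" and lin: "\<And>k V. f (k *s V) = k *s f V"
    and invol: "\<And>V. f (f V) = V" and R: "\<And>V. R V \<longleftrightarrow> R' (f V)"
  shows "transversal (f ` T) R"
proof -
  have fin: "finite T" and nz: "0 \<notin> T"
    and uniq: "\<And>U k. U \<in> T \<Longrightarrow> k *s U \<in> T \<Longrightarrow> k *s U = U"
    and R': "\<And>V. V \<noteq> 0 \<Longrightarrow> R' V \<longleftrightarrow> (\<exists>U\<in>T. \<exists>k. k \<noteq> 0 \<and> V = k *s U)"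
    using T unfolding transversal_def by blast+
  have f0: "f V = 0 \<longleftrightarrow> V = 0" for V
    using lin[of 0 V] lin[of 0 "f V"] invol[of V] by (metis vec.scale_zero_left)
  have mem: "V \<in> f ` T \<longleftrightarrow> f V \<in> T" for V
    using invol by (metis imageE image_eqI)
  show ?thesis
    unfolding transversal_def
  proof (intro conjI allI impI ballI)
    show "finite (f ` T)" using fin by simp
    show "0 \<notin> f ` T" using nz f0 by (metis mem)
    show "k *s U = U" if "U \<in> f ` T" "k *s U \<in> f ` T" for U k
      using that uniq[of "f U" k] unfolding mem lin by (metis invol lin)
    show "R V \<longleftrightarrow> (\<exists>U\<in>f ` T. \<exists>k. k \<noteq> 0 \<and> V = k *s U)" if "V \<noteq> 0" for V
    proof -
      have "R V \<longleftrightarrow> (\<exists>U\<in>T. \<exists>k. k \<noteq> 0 \<and> f V = k *s U)" using R R' f0 that by simp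
      also have "\<dots> \<longleftrightarrow> (\<exists>U\<in>T. \<exists>k. k \<noteq> 0 \<and> V = k *s f U)" using invol lin by metis
      finally show ?thesis by simp
    qed
  qed
qed

lemma flex_orbit_structure_transfer:
  assumes fos: "flex_orbit_structure a' b' c'" and lin: "\<And>k V. f (k *s V) = k *s f V"
    and invol: "\<And>V. f (f V) = V"
    and ord: "\<And>V. ordinary_flex_square a b c V \<longleftrightarrow> ordinary_flex_square a' b' c' (f V)"
    and hyp: "\<And>V. hyperflex_square a b c V \<longleftrightarrow> hyperflex_square a' b' c' (f V)"
    and one: "\<And>V. one_zero_coordinate (f V) \<longleftrightarrow> one_zero_coordinate V"
    and all: "\<And>V. f V $ 1 * f V $ 2 * f V $ 3 = V $ 1 * V $ 2 * V $ 3"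
  shows "flex_orbit_structure a b c"
proof -
  obtain S D z where *: "transversal S (ordinary_flex_square a' b' c')"
     "transversal (insert z D) (hyperflex_square a' b' c')"
     "z \<notin> D" "one_zero_coordinate z" "\<forall>V\<in>S \<union> D. V $ 1 * V $ 2 * V $ 3 \<noteq> 0"
     "card S + 2 * card D = 5"
    using fos unfolding flex_orbit_structure_def by blast
  have inj: "inj f" using invol by (metis injI)
  have "transversal (f ` S) (ordinary_flex_square a b c)"
    using transversal_transfer[OF *(1) lin invol ord] .
  moreover have "transversal (insert (f z) (f ` D)) (hyperflex_square a b c)"
    using transversal_transfer[OF *(2) lin invol hyp] by simp
  moreover have "f z \<notin> f ` D" using *(3) inj by (simp add: inj_image_mem_iff)
  moreover have "one_zero_coordinate (f z)" using *(4) one by simp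
  moreover have "\<forall>V\<in>f ` S \<union> f ` D. V $ 1 * V $ 2 * V $ 3 \<noteq> 0"
    unfolding image_Un[symmetric] using *(5) all by (simp only: ball_simps)
  moreover have "card (f ` S) + 2 * card (f ` D) = 5"
    using *(6) inj by (simp add: card_image inj_on_subset)
  ultimately show ?thesis unfolding flex_orbit_structure_def by blast
qed

lemma one_zero_coordinate_iff:
  "one_zero_coordinate V \<longleftrightarrow>
     V $ 1 = 0 \<and> V $ 2 \<noteq> 0 \<and> V $ 3 \<noteq> 0 \<or> V $ 1 \<noteq> 0 \<and> V $ 2 = 0 \<and> V $ 3 \<noteq> 0
       \<or> V $ 1 \<noteq> 0 \<and> V $ 2 \<noteq> 0 \<and> V $ 3 = 0"
proof -
  have ex3: "(\<exists>i. Q i) \<longleftrightarrow> Q 1 \<or> Q 2 \<or> Q 3" for Q :: "3 \<Rightarrow> bool"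
    by (metis exhaust_3)
  show ?thesis unfolding one_zero_coordinate_def ex3 by auto
qed

text \<open>
  Exchanging \<open>X\<close> and \<open>Y\<close> exchanges \<open>b\<close> and \<open>c\<close>, and thereby \<open>P 1\<close> and \<open>P 2\<close>; exchanging \<open>X\<close> and \<open>Z\<close>
  exchanges \<open>a\<close> and \<open>c\<close>, and thereby \<open>P 1\<close> and \<open>P 3\<close>.
\<close>

lemma flex_orbit_structure_swap12:
  assumes "flex_orbit_structure a c b"
  shows "flex_orbit_structure a b c"
proof (rule flex_orbit_structure_transfer[OF assms, where f = "\<lambda>V. vector [V $ 2, V $ 1, V $ 3]"])
  fix V :: "complex ^ 3"
  let ?f = "\<lambda>V. vector [V $ 2, V $ 1, V $ 3] :: complex ^ 3"
  have "conic_form a b c V = conic_form a c b (?f V)"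
    by (simp add: conic_form_def algebra_simps)
  moreover have "flex_cubic a b c V = flex_cubic a c b (?f V)"
    by (simp add: flex_cubic_def algebra_simps)
  moreover have "hyper_condition a b c V \<longleftrightarrow> hyper_condition a c b (?f V)"
    by (auto simp: hyper_condition_def)
  ultimately show "ordinary_flex_square a b c V \<longleftrightarrow> ordinary_flex_square a c b (?f V)"
    "hyperflex_square a b c V \<longleftrightarrow> hyperflex_square a c b (?f V)"
    by (simp_all add: ordinary_flex_square_def hyperflex_square_def)
qed (auto simp: vec_eq_iff forall_3 one_zero_coordinate_iff)

lemma flex_orbit_structure_swap13:
  assumes nd: "nondegenerate a b c" and "flex_orbit_structure c b a"
  shows "flex_orbit_structure a b c"
proof (rule flex_orbit_structure_transfer[OF assms(2), where f = "\<lambda>V. vector [V $ 3, V $ 2, V $ 1]"])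
  fix V :: "complex ^ 3"
  let ?f = "\<lambda>V. vector [V $ 3, V $ 2, V $ 1] :: complex ^ 3"
  have "conic_form a b c V = conic_form c b a (?f V)"
    by (simp add: conic_form_def algebra_simps)
  moreover have "flex_cubic a b c V = flex_cubic c b a (?f V)"
    by (simp add: flex_cubic_def algebra_simps)
  moreover have "hyper_condition a b c V \<longleftrightarrow> hyper_condition c b a (?f V)"
  proof -
    \<comment> \<open>\<open>hyper_condition\<close> compares two coordinates with the third, whose factor is \<open>a\<^sup>2 - 4\<close>; after the
        exchange this role passes to \<open>c\<^sup>2 - 4\<close>.\<close>
    have ne: "a\<^sup>2 - 4 \<noteq> 0" "c\<^sup>2 - 4 \<noteq> 0" using nd by (auto simp: nondegenerate_def)
    define x y z where xyz: "x = (V $ 1)\<^sup>2" "y = (V $ 2)\<^sup>2" "z = (V $ 3)\<^sup>2"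
    have "(b\<^sup>2 - 4) * z = (a\<^sup>2 - 4) * y \<and> (c\<^sup>2 - 4) * z = (a\<^sup>2 - 4) * x \<longleftrightarrow>
      (b\<^sup>2 - 4) * x = (c\<^sup>2 - 4) * y \<and> (a\<^sup>2 - 4) * x = (c\<^sup>2 - 4) * z"
    proof (intro iffI conjI; elim conjE)
      assume h: "(b\<^sup>2 - 4) * z = (a\<^sup>2 - 4) * y" "(c\<^sup>2 - 4) * z = (a\<^sup>2 - 4) * x"
      show "(a\<^sup>2 - 4) * x = (c\<^sup>2 - 4) * z" using h by simp
      have "(a\<^sup>2 - 4) * ((b\<^sup>2 - 4) * x - (c\<^sup>2 - 4) * y) = 0" using h by algebra
      then show "(b\<^sup>2 - 4) * x = (c\<^sup>2 - 4) * y" using ne by simp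
    next
      assume h: "(b\<^sup>2 - 4) * x = (c\<^sup>2 - 4) * y" "(a\<^sup>2 - 4) * x = (c\<^sup>2 - 4) * z"
      show "(c\<^sup>2 - 4) * z = (a\<^sup>2 - 4) * x" using h by simp
      have "(c\<^sup>2 - 4) * ((b\<^sup>2 - 4) * z - (a\<^sup>2 - 4) * y) = 0" using h by algebra
      then show "(b\<^sup>2 - 4) * z = (a\<^sup>2 - 4) * y" using ne by simp
    qed
    then show ?thesis by (simp add: hyper_condition_def xyz mult_ac)
  qed
  ultimately show "ordinary_flex_square a b c V \<longleftrightarrow> ordinary_flex_square c b a (?f V)"
    "hyperflex_square a b c V \<longleftrightarrow> hyperflex_square c b a (?f V)"
    by (simp_all add: ordinary_flex_square_def hyperflex_square_def)
qed (auto simp: vec_eq_iff forall_3 one_zero_coordinate_iff)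

section \<open>Counting the flexes\<close>

lemma flex_counts:
  assumes nd: "nondegenerate a b c" and "flex_orbit_structure a b c"
  shows "\<exists>r s. r + 2 * s = 5 \<and>
    card (ordinary_flexes a b c) = 4 * r \<and> orbit_sizes (ordinary_flexes a b c) = replicate_mset r 4 \<and>
    card (hyperflexes a b c) = 2 + 4 * s \<and>
    orbit_sizes (hyperflexes a b c) = add_mset 2 (replicate_mset s 4)"
proof -
  obtain S D z where *: "transversal S (ordinary_flex_square a b c)"
     "transversal (insert z D) (hyperflex_square a b c)"
     "z \<notin> D" "one_zero_coordinate z" "\<forall>V\<in>S \<union> D. V $ 1 * V $ 2 * V $ 3 \<noteq> 0"
     "card S + 2 * card D = 5"
    using assms(2) unfolding flex_orbit_structure_def by blast
  have fin: "finite S" "finite D" using *(1,2) by (simp_all add: transversal_def)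
  have c4: "card (fibre V) = 4" if "V \<in> S \<union> D" for V
    using card_fibre_generic *(5) that by blast
  have c2: "card (fibre z) = 2"
    using *(4) card_fibre_on_coordinate_line unfolding one_zero_coordinate_def by blast
  have const: "image_mset (\<lambda>V. card (fibre V)) (mset_set T) = replicate_mset (card T) 4"
    if "finite T" "T \<subseteq> S \<union> D" for T
  proof -
    have "image_mset (\<lambda>V. card (fibre V)) (mset_set T) = image_mset (\<lambda>V. 4) (mset_set T)"
      by (rule image_mset_cong) (use that c4 in auto)
    then show ?thesis by (simp add: image_mset_const_eq)
  qed
  have sum: "(\<Sum>V\<in>T. card (fibre V)) = 4 * card T" if "T \<subseteq> S \<union> D" for T
    using that c4 by (subst sum.cong[OF refl, where h = "\<lambda>V. 4"]) auto
  note o = orbits_by_transversal[OF *(1) flexes_by_squares(1)[OF nd]]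
  note h = orbits_by_transversal[OF *(2) flexes_by_squares(2)[OF nd]]
  show ?thesis
    using *(3,6) fin o h c2 const[of S] const[of D] sum[of S] sum[of D]
    by (intro exI[of _ "card S"] exI[of _ "card D"]) simp
qed

theorem theorem3p9:
  fixes a b c :: complex and i j k :: nat
  assumes params: "(a\<^sup>2 - 1) * (b\<^sup>2 - 1) * (c\<^sup>2 - 1) * (a\<^sup>2 - 4) * (b\<^sup>2 - 4) * (c\<^sup>2 - 4)
      * (a\<^sup>2 + b\<^sup>2 + c\<^sup>2 - a * b * c - 4) \<noteq> 0"
    and no_two_vanish: "a \<noteq> 0 \<or> b \<noteq> 0" "a \<noteq> 0 \<or> c \<noteq> 0" "b \<noteq> 0 \<or> c \<noteq> 0"
    and perm: "distinct [i, j, k]" "set [i, j, k] = {1, 2, 3}"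
    and Pi: "P i a b c = 0"
    and Pjk: "P j a b c * P k a b c \<noteq> 0"
  shows "weierstrass_points a b c = ordinary_flexes a b c \<union> hyperflexes a b c \<and>
    ((card (ordinary_flexes a b c) = 20 \<and> orbit_sizes (ordinary_flexes a b c) = {#4, 4, 4, 4, 4#} \<and>
      card (hyperflexes a b c) = 2 \<and> orbit_sizes (hyperflexes a b c) = {#2#}) \<or>
     (card (ordinary_flexes a b c) = 12 \<and> orbit_sizes (ordinary_flexes a b c) = {#4, 4, 4#} \<and>
      card (hyperflexes a b c) = 6 \<and> orbit_sizes (hyperflexes a b c) = {#2, 4#}) \<or>
     (card (ordinary_flexes a b c) = 4 \<and> orbit_sizes (ordinary_flexes a b c) = {#4#} \<and>
      card (hyperflexes a b c) = 10 \<and> orbit_sizes (hyperflexes a b c) = {#2, 4, 4#}))"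
proof -
  have "4 + a * b * c - a\<^sup>2 - b\<^sup>2 - c\<^sup>2 = - (a\<^sup>2 + b\<^sup>2 + c\<^sup>2 - a * b * c - 4)" by simp
  then have nd: "nondegenerate a b c"
    using params unfolding nondegenerate_def by (metis diff_self mult_zero_left mult_zero_right neg_equal_0_iff_equal)
  then have nd': "nondegenerate a c b" "nondegenerate c b a"
    by (auto simp: nondegenerate_def algebra_simps)
  have others: "P m a b c \<noteq> 0" if "m \<in> {1, 2, 3}" "m \<noteq> i" for m
    using that perm Pjk by auto
  have "i \<in> {1, 2, 3}" using perm by auto
  then have "flex_orbit_structure a b c"
  proof (elim insertE emptyE)
    assume i: "i = 1"
    have "P 2 a b c \<noteq> 0" "P 3 a b c \<noteq> 0" using others[of 2] others[of 3] i by auto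
    moreover have "a \<noteq> 0" "b \<noteq> 0" using Pi no_two_vanish i by (auto simp: P_def)
    ultimately show ?thesis
      using Pi i by (intro flex_orbit_structure_if_first_P_vanishes nd) (auto simp: P_def)
  next
    assume i: "i = 2"
    have "P 1 a b c \<noteq> 0" "P 3 a b c \<noteq> 0" using others[of 1] others[of 3] i by auto
    moreover have "a \<noteq> 0" "c \<noteq> 0" using Pi no_two_vanish i by (auto simp: P_def)
    ultimately have "flex_orbit_structure a c b"
      using Pi i by (intro flex_orbit_structure_if_first_P_vanishes nd') (auto simp: P_def algebra_simps)
    then show ?thesis by (rule flex_orbit_structure_swap12)
  next
    assume i: "i = 3"
    have "P 1 a b c \<noteq> 0" "P 2 a b c \<noteq> 0" using others[of 1] others[of 2] i by auto
    moreover have "b \<noteq> 0" "c \<noteq> 0" using Pi no_two_vanish i by (auto simp: P_def)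
    ultimately have "flex_orbit_structure c b a"
      using Pi i by (intro flex_orbit_structure_if_first_P_vanishes nd') (auto simp: P_def algebra_simps)
    then show ?thesis by (rule flex_orbit_structure_swap13[OF nd])
  qed
  from flex_counts[OF nd this] obtain r s where rs: "r + 2 * s = 5"
    and counts: "card (ordinary_flexes a b c) = 4 * r"
      "orbit_sizes (ordinary_flexes a b c) = replicate_mset r 4"
      "card (hyperflexes a b c) = 2 + 4 * s"
      "orbit_sizes (hyperflexes a b c) = add_mset 2 (replicate_mset s 4)"
    by blast
  have "r = 5 \<and> s = 0 \<or> r = 3 \<and> s = 1 \<or> r = 1 \<and> s = 2" using rs by presburger
  then show ?thesis
    using flexes_by_squares(3)[OF nd] counts by (auto simp: numeral_eq_Suc)
qed

end
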